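(* Let $(X,d,\mu)$ be an $\eta$-Ahlfors regular space with $\eta>0$, let $\rho$ be the third order hypermetric induced by $d$ on $X$, and let $0<\gamma<2\eta$. Then, for all real numbers $p_1>1$, $p_2>1$ and $p_3$ such that $$0<\frac{1}{p_3}=\frac{1}{p_1}+\frac{1}{p_2}-\frac{2\eta-\gamma}{\eta},$$ there exists a constant $C>0$ such that the inequality $$\|T^{\gamma}(f,g)\|_{p_3}\leq C\,\|f\|_{p_1}\,\|g\|_{p_2}$$ holds for every couple $f,g$ of measurable nonnegative functions on $X$, where $$T^{\gamma}(f,g)(x)=\iint_{X\times X}\frac{f(y)g(z)}{\rho^{\gamma}(x,y,z)}\,d\mu(y)\,d\mu(z).$$
   Context: A quasi-metric on a set $X$ is a function $d:X\times X\to[0,\infty)$ that is symmetric, vanishes exactly when its two arguments coincide, and satisfies $d(x,z)\le\kappa(d(x,y)+d(y,z))$ for all $x,y,z\in X$, for some constant $\kappa\ge 1$ (the triangular constant). Write $B_d(x,r)=\{y\in X:d(x,y)<r\}$. A space of homogeneous type $(X,d,\mu)$ is a quasi-metric space with a positive Borel measure $\mu$ for which the balls are measurable and $\mu$ is doubling on balls. For $\eta>0$, it is called $\eta$-Ahlfors regular if there exist constants $0<a\le A<\infty$ such that $a r^{\eta}\le\mu(B_d(x,r))\le A r^{\eta}$ for every $x\in X$ and every $r>0$. The third order hypermetric induced by $d$ is the function $\rho:X^3\to[0,\infty)$ given by the distance of $(x,y,z)$ to the diagonal $\{(u,u,u):u\in X\}$ with respect to the maximum quasi-metric on $X^3$,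 i.e. $\rho(x,y,z)=\inf_{u\in X}\max\{d(x,u),d(y,u),d(z,u)\}$. For $0<p<\infty$, $\|h\|_p=\left(\int_X|h|^p\,d\mu\right)^{1/p}$ (note that $p_3$ may be smaller than $1$). *)

theory Defs
  imports "HOL-Analysis.Analysis"
begin

text \<open>The underlying set of a space is an explicit carrier; for a measure space \<open>M\<close> it is
  \<open>space M\<close>, and \<open>d\<close> is unconstrained outside the carrier.\<close>

definition quasi_metric_on :: "'a set \<Rightarrow> ('a \<Rightarrow> 'a \<Rightarrow> real) \<Rightarrow> bool" where
  "quasi_metric_on X d \<longleftrightarrow>
     (\<forall>x\<in>X. \<forall>y\<in>X. 0 \<le> d x y) \<and>
     (\<forall>x\<in>X. \<forall>y\<in>X. d x y = d y x) \<and>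
     (\<forall>x\<in>X. \<forall>y\<in>X. d x y = 0 \<longleftrightarrow> x = y) \<and>
     (\<exists>\<kappa>\<ge>1. \<forall>x\<in>X. \<forall>y\<in>X. \<forall>z\<in>X. d x z \<le> \<kappa> * (d x y + d y z))"

definition qball :: "'a set \<Rightarrow> ('a \<Rightarrow> 'a \<Rightarrow> real) \<Rightarrow> 'a \<Rightarrow> real \<Rightarrow> 'a set" where
  "qball X d x r = {y \<in> X. d x y < r}"

text \<open>The topology induced by a quasi-metric. Balls need not be open in it (nor Borel), which is
  why their measurability is a separate requirement below.\<close>

definition quasi_metric_topology :: "'a set \<Rightarrow> ('a \<Rightarrow> 'a \<Rightarrow> real) \<Rightarrow> 'a topology" where
  "quasi_metric_topology X d =
     topology (\<lambda>U. U \<subseteq> X \<and> (\<forall>x\<in>U. \<exists>r>0. qball X d x r \<subseteq> U))"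

lemma openin_quasi_metric_topology:
  "openin (quasi_metric_topology X d) U \<longleftrightarrow> U \<subseteq> X \<and> (\<forall>x\<in>U. \<exists>r>0. qball X d x r \<subseteq> U)"
proof -
  have "istopology (\<lambda>U. U \<subseteq> X \<and> (\<forall>x\<in>U. \<exists>r>0. qball X d x r \<subseteq> U))"
    unfolding istopology_def
  proof (intro conjI allI impI)
    fix S T
    assume S: "S \<subseteq> X \<and> (\<forall>x\<in>S. \<exists>r>0. qball X d x r \<subseteq> S)"
      and T: "T \<subseteq> X \<and> (\<forall>x\<in>T. \<exists>r>0. qball X d x r \<subseteq> T)"
    show "S \<inter> T \<subseteq> X" using S by blast
    show "\<forall>x\<in>S \<inter> T. \<exists>r>0. qball X d x r \<subseteq> S \<inter> T"
    proof
      fix x assume "x \<in> S \<inter> T"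
      then obtain r s where "r > 0" "qball X d x r \<subseteq> S" "s > 0" "qball X d x s \<subseteq> T"
        using S T by blast
      then have "min r s > 0 \<and> qball X d x (min r s) \<subseteq> S \<inter> T"
        by (auto simp: qball_def)
      then show "\<exists>r>0. qball X d x r \<subseteq> S \<inter> T" by blast
    qed
  next
    fix K
    assume K: "\<forall>S\<in>K. S \<subseteq> X \<and> (\<forall>x\<in>S. \<exists>r>0. qball X d x r \<subseteq> S)"
    show "\<Union>K \<subseteq> X" using K by blast
    show "\<forall>x\<in>\<Union>K. \<exists>r>0. qball X d x r \<subseteq> \<Union>K"
      using K by (meson Union_iff Union_upper subset_trans)
  qed
  then show ?thesis
    by (simp add: quasi_metric_topology_def topology_inverse')
qed

text \<open>The sigma-algebra contains the Borel sets of the induced topology and the balls; it is allowed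
  to be larger than the Borel sigma-algebra (e.g. completed).\<close>

definition homogeneous_type_space :: "'a measure \<Rightarrow> ('a \<Rightarrow> 'a \<Rightarrow> real) \<Rightarrow> bool" where
  "homogeneous_type_space M d \<longleftrightarrow>
     quasi_metric_on (space M) d \<and>
     (\<forall>U. openin (quasi_metric_topology (space M) d) U \<longrightarrow> U \<in> sets M) \<and>
     (\<forall>x\<in>space M. \<forall>r>0. qball (space M) d x r \<in> sets M) \<and>
     (\<exists>D::real. \<forall>x\<in>space M. \<forall>r>0.
        0 < emeasure M (qball (space M) d x (2 * r)) \<and>
        emeasure M (qball (space M) d x (2 * r)) \<le> ennreal D * emeasure M (qball (space M) d x r) \<and>
        emeasure M (qball (space M) d x r) < \<infinity>)"

definition ahlfors_regular_space :: "'a measure \<Rightarrow> ('a \<Rightarrow> 'a \<Rightarrow> real) \<Rightarrow> real \<Rightarrow> bool" where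
  "ahlfors_regular_space M d \<eta> \<longleftrightarrow>
     homogeneous_type_space M d \<and>
     (\<exists>a A. 0 < a \<and> a \<le> A \<and>
        (\<forall>x\<in>space M. \<forall>r>0.
           ennreal (a * r powr \<eta>) \<le> emeasure M (qball (space M) d x r) \<and>
           emeasure M (qball (space M) d x r) \<le> ennreal (A * r powr \<eta>)))"

definition hypermetric3 :: "'a set \<Rightarrow> ('a \<Rightarrow> 'a \<Rightarrow> real) \<Rightarrow> 'a \<Rightarrow> 'a \<Rightarrow> 'a \<Rightarrow> real" where
  "hypermetric3 X d x y z = (INF u\<in>X. Max {d x u, d y u, d z u})"

text \<open>Real powers on \<open>[0,\<infinity>]\<close>, intended for exponents \<open>p > 0\<close> only.\<close>

definition ennreal_powr :: "ennreal \<Rightarrow> real \<Rightarrow> ennreal" where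
  "ennreal_powr x p = (if x = \<infinity> then \<infinity> else ennreal (enn2real x powr p))"

definition Lp_size :: "'a measure \<Rightarrow> real \<Rightarrow> ('a \<Rightarrow> ennreal) \<Rightarrow> ennreal" where
  "Lp_size M p h = ennreal_powr (\<integral>\<^sup>+x. ennreal_powr (h x) p \<partial>M) (1 / p)"

text \<open>Division is that of \<open>ennreal\<close>, so the kernel is \<open>\<infinity>\<close> where the hypermetric vanishes
  (that is, at \<open>y = z = x\<close>), with \<open>0 \<cdot> \<infinity> = 0\<close>.\<close>

definition frac_op ::
  "'a measure \<Rightarrow> ('a \<Rightarrow> 'a \<Rightarrow> real) \<Rightarrow> real \<Rightarrow> ('a \<Rightarrow> ennreal) \<Rightarrow> ('a \<Rightarrow> ennreal) \<Rightarrow> 'a \<Rightarrow> ennreal" where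
  "frac_op M d \<gamma> f g x =
     (\<integral>\<^sup>+(y, z). f y * g z / ennreal (hypermetric3 (space M) d x y z powr \<gamma>) \<partial>(M \<Otimes>\<^sub>M M))"

end

theory Submission
  imports Defs
begin

text \<open>
  The hypermetric dominates a multiple of \<open>max (d x y) (d x z)\<close>, so for \<open>\<gamma> = \<gamma>1 + \<gamma>2\<close> the operator is
  bounded pointwise by the product of two linear fractional integrals with kernels \<open>d powr - \<gamma>1\<close> and
  \<open>d powr - \<gamma>2\<close>. The deficit \<open>(2 * \<eta> - \<gamma>) / \<eta>\<close> is distributed proportionally to \<open>1 / p1\<close> and
  \<open>1 / p2\<close>, which puts each factor in the Hardy-Littlewood-Sobolev range. Each factor is estimated
  pointwise as by Hedberg: writing the kernel as a superposition of indicators of balls, small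
  radii are controlled by a maximal function, large radii by the norm, and the cut-off radius is
  optimised. The maximal function is bounded on \<open>L\<^sup>p\<close> through a Vitali covering argument and the
  layer cake formula.
\<close>

section \<open>Powers of extended nonnegative reals\<close>

text \<open>The linear estimates are therefore kept pointwise: each potential is at most a constant
  times the norm times a power of a measurable function (\<open>u\<close>, \<open>v\<close>) of
  bounded integral. The two exponents add up to \<open>1 / p3\<close>, so the \<open>p3\<close>-th
  power of the product is controlled by \<open>u + v\<close>, and monotonicity of the integral
  finishes without duality or Hoelder. The condition \<open>0 < 1 / p3\<close> says that the deficit
  is smaller than \<open>1 / p1 + 1 / p2\<close>, which is what keeps each proportional share
  \<open>\<alpha>1\<close>, \<open>\<alpha>2\<close> below \<open>1 / p1\<close>,
  \<open>1 / p2\<close>.\<close>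

lemma ennreal_powr_ennreal: "0 \<le> x \<Longrightarrow> ennreal_powr (ennreal x) p = ennreal (x powr p)"
  by (simp add: ennreal_powr_def)

lemma ennreal_powr_top: "ennreal_powr top p = top"
  by (simp add: ennreal_powr_def)

lemma ennreal_powr_0: "ennreal_powr 0 p = 0"
  by (simp add: ennreal_powr_def)

lemma ennreal_powr_1: "ennreal_powr x 1 = x"
  by (cases x) (simp_all add: ennreal_powr_def)

lemma ennreal_powr_measurable [measurable]:
  assumes [measurable]: "f \<in> borel_measurable M"
  shows "(\<lambda>x. ennreal_powr (f x) p) \<in> borel_measurable M"
  unfolding ennreal_powr_def by measurable

lemma ennreal_powr_mono: "x \<le> y \<Longrightarrow> 0 \<le> p \<Longrightarrow> ennreal_powr x p \<le> ennreal_powr y p"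
  by (cases x; cases y)
    (auto simp: ennreal_powr_ennreal ennreal_powr_top top_unique intro!: ennreal_leI powr_mono2)

text \<open>The convention \<open>0 * top = 0\<close>, together with \<open>ennreal_powr\<close>
  fixing \<open>0\<close> and \<open>top\<close>, makes this true for every real
  \<open>p\<close>.\<close>

lemma ennreal_powr_mult: "ennreal_powr (x * y) p = ennreal_powr x p * ennreal_powr y p"
proof (cases "x = 0 \<or> y = 0")
  case False
  then show ?thesis
    by (cases x; cases y)
      (auto simp: ennreal_powr_ennreal ennreal_powr_top ennreal_mult'[symmetric] powr_mult
        ennreal_mult_eq_top_iff top_unique ennreal_mult_top ennreal_top_mult)
qed (auto simp: ennreal_powr_0)

lemma ennreal_powr_powr: "ennreal_powr (ennreal_powr x p) q = ennreal_powr x (p * q)"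
  by (cases x) (simp_all add: ennreal_powr_ennreal ennreal_powr_top powr_powr)

lemma ennreal_powr_add:
  assumes "0 < p" "0 < q"
  shows "ennreal_powr x (p + q) = ennreal_powr x p * ennreal_powr x q"
  by (cases x) (simp_all add: ennreal_powr_ennreal ennreal_powr_top powr_add ennreal_mult)

lemma ennreal_powr_eq_0_iff: "ennreal_powr x p = 0 \<longleftrightarrow> x = 0"
  by (cases x) (auto simp: ennreal_powr_ennreal ennreal_powr_top)

text \<open>A crude Young inequality in place of Hoelder: both factors are dominated by powers of
  \<open>max u v\<close>.\<close>

lemma ennreal_powr_mult_le_add:
  assumes "0 < s" "0 < t" "s + t = 1"
  shows "ennreal_powr u s * ennreal_powr v t \<le> u + v"
proof -
  have "ennreal_powr u s * ennreal_powr v t \<le> ennreal_powr (max u v) s * ennreal_powr (max u v) t"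
    using assms by (intro mult_mono ennreal_powr_mono) auto
  also have "\<dots> = max u v"
    using ennreal_powr_add[of s t "max u v"] assms by (simp add: ennreal_powr_1)
  also have "\<dots> \<le> u + v" by (simp add: max_def)
  finally show ?thesis .
qed

text \<open>Hedberg's choice of the cut-off: the two terms agree when \<open>R\<close> is
  \<open>m\<close> to the power \<open>- 1 / (a + b)\<close>. For \<open>m = 0\<close> no such
  radius exists, and large \<open>R\<close> forces \<open>X = 0\<close>.\<close>

lemma le_powr_if_le_balanced_sum:
  fixes X m :: ennreal
  assumes a: "0 < a" and b: "0 < b" and C: "0 < C"
    and le: "\<And>R. 0 < R \<Longrightarrow> X \<le> ennreal C * (ennreal (R powr a) * m + ennreal (R powr - b))"
  shows "X \<le> ennreal (2 * C) * ennreal_powr m (b / (a + b))"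
proof (cases "m = 0")
  case True
  have "X = 0"
  proof (rule ccontr)
    assume "X \<noteq> 0"
    moreover have "X \<noteq> top"
      using le[of 1] True by (auto simp: top_unique ennreal_mult_eq_top_iff)
    ultimately obtain x where x: "X = ennreal x" "0 < x"
      by (cases X) (auto simp: less_le)
    \<comment> \<open>Chosen so that \<open>C * R powr - b\<close> is half of \<open>x\<close>,
      which the assumed bound cannot allow.\<close>
    define R where "R = (x / (2 * C)) powr (- 1 / b)"
    have "ennreal x \<le> ennreal (C * R powr - b)"
      using le[of R] True x C by (simp add: R_def ennreal_mult')
    also have "C * R powr - b = x / 2"
      using x C b by (simp add: R_def powr_powr)
    finally show False using x by simp
  qed
  then show ?thesis by simp
next
  case False
  show ?thesis
  proof (cases m)
    case (real v)
    with False have v: "0 < v" by (auto simp: less_le)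
    define R where "R = v powr (- 1 / (a + b))"
    have R: "0 < R" using v by (simp add: R_def)
    have 1: "R powr a * v = v powr (b / (a + b))"
    proof -
      have "R powr a * v = v powr (- 1 / (a + b) * a) * v powr 1"
        using v by (simp only: R_def powr_powr powr_one)
      also have "\<dots> = v powr (- 1 / (a + b) * a + 1)" by (simp only: powr_add)
      also have "- 1 / (a + b) * a + 1 = b / (a + b)" using a b by (simp add: field_simps)
      finally show ?thesis .
    qed
    have 2: "R powr - b = v powr (b / (a + b))"
      by (simp add: R_def powr_powr)
    have "X \<le> ennreal C * (ennreal (R powr a) * m + ennreal (R powr - b))"
      by (rule le[OF R])
    also have "ennreal (R powr a) * m + ennreal (R powr - b) = ennreal (2 * v powr (b / (a + b)))"
      using v real by (simp add: 1 2 ennreal_mult'[symmetric] flip: ennreal_plus)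
    also have "ennreal C * \<dots> = ennreal (2 * C) * ennreal_powr m (b / (a + b))"
      using C v real by (simp add: ennreal_powr_ennreal ennreal_mult'[symmetric])
    finally show ?thesis .
  next
    case top
    then show ?thesis using C by (simp add: ennreal_powr_top ennreal_mult_top)
  qed
qed

text \<open>Above the level \<open>t\<close> one has \<open>(v / t) powr (p - 1) \<ge> 1\<close>;
  below it the first term suffices. Integrated over a ball with \<open>t\<close> tuned to the
  radius, this acts as Hoelder's inequality.\<close>

lemma le_add_powr:
  assumes t: "0 < t" and p: "1 \<le> p"
  shows "v \<le> ennreal t + ennreal (t powr (1 - p)) * ennreal_powr v p"
proof (cases v)
  case (real r)
  have "r \<le> t + t powr (1 - p) * r powr p"
  proof (cases "r \<le> t")
    case False
    then have r: "t < r" "0 < r" using t by auto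
    have "r = r powr (1 - p) * r powr p" using r by (simp flip: powr_add)
    also have "\<dots> \<le> t powr (1 - p) * r powr p"
      using r t p by (intro mult_right_mono powr_mono2') auto
    finally show ?thesis using t by linarith
  qed (auto intro: add_increasing2)
  then show ?thesis
    using real t by (simp add: ennreal_powr_ennreal ennreal_mult'[symmetric] flip: ennreal_plus)
next
  case top
  then show ?thesis using t by (simp add: ennreal_powr_top ennreal_mult_top)
qed

section \<open>Power integrals and the layer cake formula\<close>

lemma nn_integral_powr_below_real:
  fixes p :: real
  assumes p: "0 < p" and c: "0 \<le> c"
  shows "(\<integral>\<^sup>+t. (if 0 < t \<and> t < c then ennreal (t powr (p - 1)) else 0) \<partial>lborel)
    = ennreal (1 / p * c powr p)"
proof -
  have "(\<integral>\<^sup>+t. (if 0 < t \<and> t < c then ennreal (t powr (p - 1)) else 0) \<partial>lborel)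
      = (\<integral>\<^sup>+t\<in>{0..c}. ennreal (t powr (p - 1)) \<partial>lborel)"
  proof (rule nn_integral_cong_AE)
    show "AE t in lborel. (if 0 < t \<and> t < c then ennreal (t powr (p - 1)) else 0) =
        ennreal (t powr (p - 1)) * indicator {0..c} t"
      using AE_lborel_singleton[of 0] AE_lborel_singleton[of c]
      by eventually_elim (auto simp: indicator_def)
  qed
  also have "\<dots> = ennreal (c powr (p - 1 + 1) / (p - 1 + 1))"
    by (intro nn_integral_has_integral_lebesgue' has_integral_powr_from_0) (use p c in auto)
  finally show ?thesis by simp
qed

text \<open>The layer cake formula at a single point. For \<open>u = top\<close> divergence follows
  because every positive real is the value of the integral up to some finite level
  \<open>c\<close>.\<close>

lemma nn_integral_powr_below:
  fixes p :: real
  assumes p: "0 < p"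
  shows "(\<integral>\<^sup>+t. (if 0 < t \<and> ennreal t < u then ennreal (t powr (p - 1)) else 0) \<partial>lborel)
    = ennreal (1 / p) * ennreal_powr u p"
proof (cases u)
  case (real c)
  have "(\<integral>\<^sup>+t. (if 0 < t \<and> ennreal t < u then ennreal (t powr (p - 1)) else 0) \<partial>lborel) =
    (\<integral>\<^sup>+t. (if 0 < t \<and> t < c then ennreal (t powr (p - 1)) else 0) \<partial>lborel)"
    using real by (intro nn_integral_cong) (auto simp: ennreal_less_iff)
  then show ?thesis
    using real p by (simp add: nn_integral_powr_below_real ennreal_powr_ennreal ennreal_mult'[symmetric])
next
  case top
  let ?J = "\<integral>\<^sup>+t. (if 0 < t \<and> ennreal t < u then ennreal (t powr (p - 1)) else 0) \<partial>lborel"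
  have ge: "ennreal r \<le> ?J" for r
  proof (cases "r \<le> 0")
    case False
    define c where "c = (p * r) powr (1 / p)"
    have "ennreal r = ennreal (1 / p * c powr p)"
      using False p by (simp add: c_def powr_powr)
    also have "\<dots> = (\<integral>\<^sup>+t. (if 0 < t \<and> t < c then ennreal (t powr (p - 1)) else 0) \<partial>lborel)"
      using p by (intro nn_integral_powr_below_real[symmetric]) (auto simp: c_def)
    also have "\<dots> \<le> ?J"
      using top by (intro nn_integral_mono) auto
    finally show ?thesis .
  qed (simp add: ennreal_neg)
  have "?J = top"
  proof (rule ccontr)
    assume "?J \<noteq> top"
    then obtain j where j: "0 \<le> j" "?J = ennreal j" by (cases ?J) auto
    show False using ge[of "j + 1"] j by simp
  qed
  then show ?thesis using top p by (simp add: ennreal_powr_top ennreal_mult_top)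
qed

text \<open>With \<open>a = d x y\<close> this writes the kernel as a superposition of indicators of
  the balls around \<open>x\<close> that contain \<open>y\<close>. At \<open>a = 0\<close> both
  sides are \<open>top\<close>, matching the infinite kernel on the diagonal.\<close>

lemma nn_integral_powr_above:
  fixes a g :: real
  assumes a: "0 \<le> a" and g: "0 < g"
  shows "(\<integral>\<^sup>+t. (if a < t then ennreal (t powr (- g - 1)) else 0) \<partial>lborel)
    = ennreal (1 / g) * inverse (ennreal (a powr g))"
proof -
  have pos: "(\<integral>\<^sup>+t. (if b < t then ennreal (t powr (- g - 1)) else 0) \<partial>lborel)
    = ennreal (1 / g * b powr - g)" if b: "0 < b" for b
  proof -
    have "(\<integral>\<^sup>+t. (if b < t then ennreal (t powr (- g - 1)) else 0) \<partial>lborel)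
      = (\<integral>\<^sup>+t\<in>{b..}. ennreal (t powr (- g - 1)) \<partial>lborel)"
    proof (rule nn_integral_cong_AE)
      show "AE t in lborel. (if b < t then ennreal (t powr (- g - 1)) else 0) =
          ennreal (t powr (- g - 1)) * indicator {b..} t"
        using AE_lborel_singleton[of b] by eventually_elim (auto simp: indicator_def)
    qed
    also have "\<dots> = ennreal (- (b powr (- g - 1 + 1)) / (- g - 1 + 1))"
      by (intro nn_integral_has_integral_lebesgue' has_integral_powr_to_inf) (use b g in auto)
    finally show ?thesis by simp
  qed
  show ?thesis
  proof (cases "a = 0")
    case False
    then show ?thesis
      using a g by (simp add: pos inverse_ennreal powr_minus ennreal_mult'[symmetric])
  next
    case True
    let ?J = "\<integral>\<^sup>+t. (if a < t then ennreal (t powr (- g - 1)) else 0) \<partial>lborel"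
    have ge: "ennreal r \<le> ?J" if r: "0 < r" for r
    proof -
      define b where "b = (g * r) powr (- 1 / g)"
      have b: "0 < b" using r g by (simp add: b_def)
      have "ennreal r = ennreal (1 / g * b powr - g)"
        using r g by (simp add: b_def powr_powr)
      also have "\<dots> = (\<integral>\<^sup>+t. (if b < t then ennreal (t powr (- g - 1)) else 0) \<partial>lborel)"
        using pos[OF b] by simp
      also have "\<dots> \<le> ?J"
        using True b by (intro nn_integral_mono) auto
      finally show ?thesis .
    qed
    have "?J = top"
    proof (rule ccontr)
      assume "?J \<noteq> top"
      then obtain j where j: "0 \<le> j" "?J = ennreal j" by (cases ?J) auto
      show False using ge[of "j + 1"] j by simp
    qed
    then show ?thesis using True g by (simp add: ennreal_mult_top)
  qed
qed

text \<open>Tonelli applied to \<open>nn_integral_powr_below\<close>; the exchange is where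
  sigma-finiteness enters.\<close>

lemma (in sigma_finite_measure) nn_integral_layer_cake:
  assumes [measurable]: "u \<in> borel_measurable M" and p: "0 < p"
  shows "(\<integral>\<^sup>+x. ennreal_powr (u x) p \<partial>M) = ennreal p *
    (\<integral>\<^sup>+t. (if 0 < t then ennreal (t powr (p - 1)) * emeasure M {x \<in> space M. ennreal t < u x} else 0) \<partial>lborel)"
proof -
  interpret P: pair_sigma_finite M lborel
    by (intro pair_sigma_finite.intro sigma_finite_measure_axioms lborel.sigma_finite_measure_axioms)
  have "(\<integral>\<^sup>+x. ennreal_powr (u x) p \<partial>M) = (\<integral>\<^sup>+x. ennreal p *
      (\<integral>\<^sup>+t. (if 0 < t \<and> ennreal t < u x then ennreal (t powr (p - 1)) else 0) \<partial>lborel) \<partial>M)"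
    using p by (simp add: nn_integral_powr_below mult.assoc[symmetric] ennreal_mult'[symmetric])
  also have "\<dots> = ennreal p * (\<integral>\<^sup>+x. (\<integral>\<^sup>+t. (if 0 < t \<and> ennreal t < u x then ennreal (t powr (p - 1)) else 0) \<partial>lborel) \<partial>M)"
    by (intro nn_integral_cmult) measurable
  also have "(\<integral>\<^sup>+x. (\<integral>\<^sup>+t. (if 0 < t \<and> ennreal t < u x then ennreal (t powr (p - 1)) else 0) \<partial>lborel) \<partial>M)
     = (\<integral>\<^sup>+t. (\<integral>\<^sup>+x. (if 0 < t \<and> ennreal t < u x then ennreal (t powr (p - 1)) else 0) \<partial>M) \<partial>lborel)"
    by (intro P.Fubini'[symmetric]) measurable
  also have "\<dots> = (\<integral>\<^sup>+t. (if 0 < t then ennreal (t powr (p - 1)) * emeasure M {x \<in> space M. ennreal t < u x} else 0) \<partial>lborel)"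
  proof (rule nn_integral_cong)
    fix t :: real
    have "(\<integral>\<^sup>+x. (if 0 < t \<and> ennreal t < u x then ennreal (t powr (p - 1)) else 0) \<partial>M) =
      (\<integral>\<^sup>+x. (if 0 < t then ennreal (t powr (p - 1)) else 0) * indicator {x \<in> space M. ennreal t < u x} x \<partial>M)"
      by (intro nn_integral_cong) (auto simp: indicator_def)
    then show "(\<integral>\<^sup>+x. (if 0 < t \<and> ennreal t < u x then ennreal (t powr (p - 1)) else 0) \<partial>M) =
       (if 0 < t then ennreal (t powr (p - 1)) * emeasure M {x \<in> space M. ennreal t < u x} else 0)"
      by (simp add: nn_integral_cmult_indicator)
  qed
  finally show ?thesis .
qed

section \<open>The maximal function on an Ahlfors regular space\<close>

text \<open>The existential constants of the hypotheses are fixed here, so that dilation factors and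
  bounds below can be explicit expressions in \<open>\<kappa>\<close>, \<open>a\<close> and
  \<open>A\<close>.\<close>

locale ahlfors_quasi_metric =
  fixes M :: "'a measure" and d :: "'a \<Rightarrow> 'a \<Rightarrow> real" and \<eta> \<kappa> a A :: real
  assumes eta_pos: "0 < \<eta>" and kappa_ge_1: "1 \<le> \<kappa>" and a_pos: "0 < a" and A_pos: "0 < A"
    and dist_nonneg: "x \<in> space M \<Longrightarrow> y \<in> space M \<Longrightarrow> 0 \<le> d x y"
    and dist_self: "x \<in> space M \<Longrightarrow> d x x = 0"
    and dist_sym: "x \<in> space M \<Longrightarrow> y \<in> space M \<Longrightarrow> d x y = d y x"
    and dist_triangle: "x \<in> space M \<Longrightarrow> y \<in> space M \<Longrightarrow> z \<in> space M \<Longrightarrow>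
          d x z \<le> \<kappa> * (d x y + d y z)"
    and sets_ball_pos: "x \<in> space M \<Longrightarrow> 0 < r \<Longrightarrow> qball (space M) d x r \<in> sets M"
    and ball_lower: "x \<in> space M \<Longrightarrow> 0 < r \<Longrightarrow>
          ennreal (a * r powr \<eta>) \<le> emeasure M (qball (space M) d x r)"
    and ball_upper: "x \<in> space M \<Longrightarrow> 0 < r \<Longrightarrow>
          emeasure M (qball (space M) d x r) \<le> ennreal (A * r powr \<eta>)"
begin

abbreviation B :: "'a \<Rightarrow> real \<Rightarrow> 'a set" where
  "B \<equiv> qball (space M) d"

lemma ball_subset_space: "B x r \<subseteq> space M"
  by (auto simp: qball_def)

lemma in_ball_self: "x \<in> space M \<Longrightarrow> 0 < r \<Longrightarrow> x \<in> B x r"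
  by (simp add: qball_def dist_self)

lemma sets_ball [measurable]: "x \<in> space M \<Longrightarrow> B x r \<in> sets M"
proof (cases "0 < r")
  case False
  assume "x \<in> space M"
  with False have "B x r = {}"
    using dist_nonneg by (fastforce simp: qball_def)
  then show ?thesis by simp
qed (rule sets_ball_pos)

lemma dist_measurable [measurable]: "x \<in> space M \<Longrightarrow> d x \<in> borel_measurable M"
  unfolding borel_measurable_iff_less using sets_ball by (auto simp: qball_def)

lemma emeasure_ball_finite: "x \<in> space M \<Longrightarrow> 0 < r \<Longrightarrow> emeasure M (B x r) < \<infinity>"
  using ball_upper[of x r] by (auto intro: le_less_trans simp: ennreal_less_top)

lemma ball_mono: "r \<le> s \<Longrightarrow> B x r \<subseteq> B x s"
  by (auto simp: qball_def)

lemma triangle_less: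
  assumes "x \<in> space M" "y \<in> space M" "z \<in> space M" "d x y < r" "d y z < s"
  shows "d x z < \<kappa> * (r + s)"
proof -
  have "d x z \<le> \<kappa> * (d x y + d y z)" by (rule dist_triangle[OF assms(1-3)])
  also have "\<dots> < \<kappa> * (r + s)" using assms(4,5) kappa_ge_1 by simp
  finally show ?thesis .
qed

lemma ball_subset_ball:
  assumes "x \<in> space M" "y \<in> space M" "d x y < r"
  shows "B y s \<subseteq> B x (\<kappa> * (r + s))"
  using triangle_less[OF assms(1,2) _ assms(3)] by (auto simp: qball_def)

lemma sigma_finite: "sigma_finite_measure M"
proof (cases "space M = {}")
  case True
  then show ?thesis
    by (intro sigma_finite_measure.intro exI[of _ "{}"]) auto
next
  case False
  then obtain x0 where x0: "x0 \<in> space M" by auto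
  have "space M = (\<Union>n::nat. B x0 (Suc n))"
  proof (intro equalityI subsetI)
    fix x assume "x \<in> space M"
    moreover obtain n :: nat where "d x0 x < n" using reals_Archimedean2 by blast
    ultimately show "x \<in> (\<Union>n::nat. B x0 (Suc n))"
      by (auto simp: qball_def intro!: exI[of _ n])
  qed (use ball_subset_space in blast)
  then show ?thesis
    using x0 emeasure_ball_finite[OF x0]
    by (intro sigma_finite_measure.intro exI[of _ "range (\<lambda>n::nat. B x0 (Suc n))"])
       (auto simp: less_top[symmetric])
qed

section \<open>Packing, finite nets and separability\<close>

text \<open>Volume packing: balls of radius \<open>r / (2 * \<kappa>)\<close> around separated
  points are disjoint, lie in one larger ball, and each has at least the lower Ahlfors mass, so a
  ratio of masses bounds their number.\<close>

lemma separated_card_bound: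
  assumes x0: "x0 \<in> space M" and R: "0 < R" and r: "0 < r"
  shows "\<exists>N. \<forall>S. finite S \<and> S \<subseteq> B x0 R \<and> (\<forall>c\<in>S. \<forall>c'\<in>S. c \<noteq> c' \<longrightarrow> r \<le> d c c')
           \<longrightarrow> card S \<le> N"
proof (intro exI allI impI)
  fix S assume S: "finite S \<and> S \<subseteq> B x0 R \<and> (\<forall>c\<in>S. \<forall>c'\<in>S. c \<noteq> c' \<longrightarrow> r \<le> d c c')"
  define s where "s = r / (2 * \<kappa>)"
  have s: "0 < s" using r kappa_ge_1 by (simp add: s_def)
  have S_space: "c \<in> space M" if "c \<in> S" for c using S that ball_subset_space by auto
  have disj: "disjoint_family_on (\<lambda>c. B c s) S"
    unfolding disjoint_family_on_def
  proof (intro ballI impI, rule ccontr)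
    fix c c' assume c: "c \<in> S" "c' \<in> S" "c \<noteq> c'" and "B c s \<inter> B c' s \<noteq> {}"
    then obtain w where w: "w \<in> space M" "d c w < s" "d c' w < s" by (auto simp: qball_def)
    have "d c c' < \<kappa> * (s + s)"
      using triangle_less[of c w c' s s] w c S_space dist_sym[of c' w] by auto
    also have "\<dots> = r" using kappa_ge_1 by (simp add: s_def)
    finally show False using S c by force
  qed
  have "ennreal (card S * (a * s powr \<eta>)) = (\<Sum>c\<in>S. ennreal (a * s powr \<eta>))"
    using a_pos by (simp add: ennreal_mult' ennreal_of_nat_eq_real_of_nat)
  also have "\<dots> \<le> (\<Sum>c\<in>S. emeasure M (B c s))"
    by (intro sum_mono ball_lower S_space s)
  also have "\<dots> = emeasure M (\<Union>c\<in>S. B c s)"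
    by (intro sum_emeasure disj) (use S S_space in auto)
  also have "\<dots> \<le> emeasure M (B x0 (\<kappa> * (R + s)))"
  proof (intro emeasure_mono sets_ball x0 UN_least)
    fix c assume "c \<in> S"
    then show "B c s \<subseteq> B x0 (\<kappa> * (R + s))"
      using S S_space[of c] by (intro ball_subset_ball x0) (auto simp: qball_def)
  qed
  also have "\<dots> \<le> ennreal (A * (\<kappa> * (R + s)) powr \<eta>)"
    using R s kappa_ge_1 by (intro ball_upper x0) auto
  finally have "card S * (a * s powr \<eta>) \<le> A * (\<kappa> * (R + s)) powr \<eta>"
    using A_pos by (subst (asm) ennreal_le_iff) auto
  then have "card S \<le> A * (\<kappa> * (R + s)) powr \<eta> / (a * s powr \<eta>)"
    using a_pos s by (simp add: field_simps)
  then show "card S \<le> nat \<lfloor>A * (\<kappa> * (R + r / (2 * \<kappa>))) powr \<eta> / (a * (r / (2 * \<kappa>)) powr \<eta>)\<rfloor>"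
    unfolding s_def by (simp add: le_nat_floor)
qed

text \<open>A separated set of greatest cardinality is a net: a point far from all its members could
  be added to it.\<close>

lemma finite_net:
  assumes x0: "x0 \<in> space M" and R: "0 < R" and r: "0 < r"
  shows "\<exists>S. finite S \<and> S \<subseteq> B x0 R \<and> (\<forall>y\<in>B x0 R. \<exists>c\<in>S. d c y < r)"
proof -
  define P where "P S \<longleftrightarrow> finite S \<and> S \<subseteq> B x0 R \<and> (\<forall>c\<in>S. \<forall>c'\<in>S. c \<noteq> c' \<longrightarrow> r \<le> d c c')" for S
  obtain N where N: "\<And>S. P S \<Longrightarrow> card S \<le> N"
    using separated_card_bound[OF assms] unfolding P_def by auto
  have "P {}" by (simp add: P_def)
  from ex_has_greatest_nat[of P, OF this, of card "Suc N"] N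
  obtain S where S: "P S" and max: "\<And>T. P T \<Longrightarrow> card T \<le> card S" by (auto simp: less_Suc_eq_le)
  have "\<exists>c\<in>S. d c y < r" if y: "y \<in> B x0 R" for y
  proof (rule ccontr)
    assume "\<not> ?thesis"
    then have far: "\<And>c. c \<in> S \<Longrightarrow> r \<le> d c y" by force
    have ysp: "y \<in> space M" using y ball_subset_space by auto
    have "y \<notin> S" using far[of y] r dist_self[OF ysp] by auto
    have "r \<le> d c y \<and> r \<le> d y c" if "c \<in> S" for c
      using far[OF that] dist_sym[OF ysp, of c] S that ball_subset_space[of x0 R]
      by (auto simp: P_def)
    then have "P (insert y S)" using S y by (simp add: P_def)
    from max[OF this] show False using S \<open>y \<notin> S\<close> by (simp add: P_def)
  qed
  then show ?thesis using S by (auto simp: P_def)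
qed

text \<open>Finite nets of growing balls at scales \<open>1 / Suc k\<close> are collected. The
  result supplies the centres of a countable family of balls.\<close>

lemma separable:
  "\<exists>D. countable D \<and> D \<subseteq> space M \<and> (\<forall>x\<in>space M. \<forall>r>0. \<exists>c\<in>D. d c x < r)"
proof (cases "space M = {}")
  case False
  then obtain x0 where x0: "x0 \<in> space M" by auto
  have "\<forall>n k::nat. \<exists>S. finite S \<and> S \<subseteq> B x0 (Suc n) \<and>
          (\<forall>y\<in>B x0 (Suc n). \<exists>c\<in>S. d c y < 1 / Suc k)"
    by (intro allI finite_net x0) auto
  then obtain S where S: "\<And>n k. finite (S n k)" "\<And>n k. S n k \<subseteq> B x0 (Suc n)"
    "\<And>n k y. y \<in> B x0 (Suc n) \<Longrightarrow> \<exists>c\<in>S n k. d c y < 1 / Suc k"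
    by metis
  show ?thesis
  proof (intro exI[of _ "\<Union>n k. S n k"] conjI ballI allI impI)
    show "countable (\<Union>n k. S n k)" using countable_finite[OF S(1)] by (intro countable_UN) auto
    show "(\<Union>n k. S n k) \<subseteq> space M" using S(2) ball_subset_space by blast
    fix x r assume x: "x \<in> space M" and r: "0 < (r::real)"
    obtain n :: nat where n: "d x0 x < n" using reals_Archimedean2 by blast
    obtain k where k: "1 / Suc k < r" using r nat_approx_posE by blast
    have "x \<in> B x0 (Suc n)" using n x by (simp add: qball_def)
    from S(3)[OF this, of k] show "\<exists>c\<in>\<Union>n k. S n k. d c x < r"
      using k by force
  qed
next
  case True
  then show ?thesis by (intro exI[of _ "{}"]) simp
qed

definition dense_subset :: "'a set" where
  "dense_subset = (SOME D. countable D \<and> D \<subseteq> space M \<and> (\<forall>x\<in>space M. \<forall>r>0. \<exists>c\<in>D. d c x < r))"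

lemma countable_dense_subset: "countable dense_subset"
  and dense_subset_space: "dense_subset \<subseteq> space M"
  and dense_subset: "x \<in> space M \<Longrightarrow> 0 < r \<Longrightarrow> \<exists>c\<in>dense_subset. d c x < r"
  using someI_ex[OF separable] unfolding dense_subset_def[symmetric] by auto

section \<open>The maximal function over countably many balls\<close>

definition ball_indices :: "('a \<times> real) set" where
  "ball_indices = dense_subset \<times> {s \<in> \<rat>. 0 < s}"

lemma countable_ball_indices: "countable ball_indices"
  unfolding ball_indices_def using countable_rat
  by (intro countable_SIGMA countable_dense_subset) (auto intro: countable_subset)

lemma ball_indicesD: "i \<in> ball_indices \<Longrightarrow> fst i \<in> space M \<and> 0 < snd i"
  using dense_subset_space by (auto simp: ball_indices_def)

text \<open>Restricting to countably many balls makes the maximal function measurable even though the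
  balls need not be open; normalising by \<open>s powr \<eta>\<close> instead of the measure of the ball is harmless
  by regularity.\<close>

definition maximal :: "('a \<Rightarrow> ennreal) \<Rightarrow> 'a \<Rightarrow> ennreal" where
  "maximal f x = (SUP (c, s)\<in>ball_indices.
     ennreal (s powr - \<eta>) * (\<integral>\<^sup>+y\<in>B c s. f y \<partial>M) * indicator (B c s) x)"

lemma maximal_measurable [measurable]: "maximal f \<in> borel_measurable M"
proof -
  have "(\<lambda>x. SUP i\<in>ball_indices. case i of (c, s) \<Rightarrow>
      ennreal (s powr - \<eta>) * (\<integral>\<^sup>+y\<in>B c s. f y \<partial>M) * indicator (B c s) x) \<in> borel_measurable M"
  proof (intro borel_measurable_SUP countable_ball_indices)
    fix i assume "i \<in> ball_indices"
    then have [measurable]: "B (fst i) (snd i) \<in> sets M" using ball_indicesD by auto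
    show "(\<lambda>x. case i of (c, s) \<Rightarrow>
      ennreal (s powr - \<eta>) * (\<integral>\<^sup>+y\<in>B c s. f y \<partial>M) * indicator (B c s) x) \<in> borel_measurable M"
      unfolding split_beta by measurable
  qed
  then show ?thesis by (simp add: maximal_def[abs_def])
qed

text \<open>Passing to the countable family costs only a constant factor: with
  \<open>d c x < r\<close>, a radius \<open>s\<close> above \<open>2 * \<kappa> * r\<close> makes
  \<open>B c s\<close> contain \<open>B x r\<close>, and keeping \<open>s\<close> below
  \<open>4 * \<kappa> * r\<close> gives the constant.\<close>

lemma ball_integral_le_maximal:
  assumes x: "x \<in> space M" and r: "0 < r"
  shows "(\<integral>\<^sup>+y\<in>B x r. f y \<partial>M) \<le> ennreal ((4 * \<kappa> * r) powr \<eta>) * maximal f x"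
proof -
  obtain c where c: "c \<in> dense_subset" "d c x < r" using dense_subset[OF x r] by auto
  then have csp: "c \<in> space M" using dense_subset_space by auto
  obtain s where s: "s \<in> \<rat>" "2 * \<kappa> * r < s" "s < 4 * \<kappa> * r"
    using Rats_dense_in_real[of "2 * \<kappa> * r" "4 * \<kappa> * r"] kappa_ge_1 r by auto
  have "r \<le> 2 * \<kappa> * r" using kappa_ge_1 r by simp
  with s r have s0: "0 < s" and rs: "r < s" by linarith+
  have sub: "B x r \<subseteq> B c s"
    using ball_subset_ball[OF csp x c(2), of r] ball_mono[of "\<kappa> * (r + r)" s c] s(2)
    by (auto simp: algebra_simps)
  have xB: "x \<in> B c s" using x c rs by (simp add: qball_def)
  have "(\<integral>\<^sup>+y\<in>B x r. f y \<partial>M) \<le> (\<integral>\<^sup>+y\<in>B c s. f y \<partial>M)"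
    using sub by (intro nn_integral_mono mult_left_mono) (auto simp: indicator_def)
  also have "\<dots> = ennreal (s powr \<eta>) *
      (ennreal (s powr - \<eta>) * (\<integral>\<^sup>+y\<in>B c s. f y \<partial>M) * indicator (B c s) x)"
    using xB s0 by (simp add: mult.assoc[symmetric] ennreal_mult'[symmetric] powr_minus)
  also have "\<dots> \<le> ennreal ((4 * \<kappa> * r) powr \<eta>) * maximal f x"
  proof (rule mult_mono)
    show "ennreal (s powr \<eta>) \<le> ennreal ((4 * \<kappa> * r) powr \<eta>)"
      using s s0 eta_pos by (intro ennreal_leI powr_mono2) auto
    show "ennreal (s powr - \<eta>) * (\<integral>\<^sup>+y\<in>B c s. f y \<partial>M) * indicator (B c s) x \<le> maximal f x"
      unfolding maximal_def using c s s0
      by (intro SUP_upper2[of "(c, s)"]) (auto simp: ball_indices_def)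
  qed auto
  finally show ?thesis .
qed

section \<open>Vitali covering, weak type and strong type bounds\<close>

text \<open>Greedy selection by induction: keep a ball of largest radius, discard all balls that
  meet it, recurse on the rest. A pair consists of a centre and a radius.\<close>

lemma vitali_finite:
  assumes "finite F" "\<And>i. i \<in> F \<Longrightarrow> fst i \<in> space M \<and> 0 < snd i"
  shows "\<exists>G\<subseteq>F. disjoint_family_on (\<lambda>i. B (fst i) (snd i)) G \<and>
    (\<Union>i\<in>F. B (fst i) (snd i)) \<subseteq> (\<Union>i\<in>G. B (fst i) (\<kappa> * (1 + 2 * \<kappa>) * snd i))"
  using assms
proof (induction F rule: finite_psubset_induct)
  case (psubset F)
  show ?case
  proof (cases "F = {}")
    case False
    obtain i where i: "i \<in> F" and imax: "\<And>j. j \<in> F \<Longrightarrow> snd j \<le> snd i"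
      using psubset.hyps False Max_in[of "snd ` F"] Max_ge[of "snd ` F"]
      by (metis (no_types, lifting) finite_imageI imageE imageI image_is_empty)
    define F' where "F' = {j \<in> F. B (fst j) (snd j) \<inter> B (fst i) (snd i) = {}}"
    have "i \<notin> F'" using psubset.prems[OF i] in_ball_self by (auto simp: F'_def)
    then have "F' \<subset> F" using i by (auto simp: F'_def)
    from psubset.IH[OF this] psubset.prems \<open>F' \<subset> F\<close>
    obtain G where G: "G \<subseteq> F'" "disjoint_family_on (\<lambda>i. B (fst i) (snd i)) G"
      "(\<Union>i\<in>F'. B (fst i) (snd i)) \<subseteq> (\<Union>i\<in>G. B (fst i) (\<kappa> * (1 + 2 * \<kappa>) * snd i))"
      by (metis (no_types, lifting) psubsetD)
    \<comment> \<open>Through a common point \<open>w\<close> of the two balls: \<open>y\<close> is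
      within \<open>2 * \<kappa> * snd j\<close> of \<open>w\<close>, and \<open>w\<close> within
      \<open>snd i\<close> of \<open>fst i\<close>. As \<open>snd j \<le> snd i\<close>, a second
      triangle inequality yields the dilation \<open>\<kappa> * (1 + 2 * \<kappa>)\<close>.\<close>
    have near: "B (fst j) (snd j) \<subseteq> B (fst i) (\<kappa> * (1 + 2 * \<kappa>) * snd i)" if j: "j \<in> F" "j \<notin> F'" for j
    proof
      fix y assume y: "y \<in> B (fst j) (snd j)"
      obtain w where w: "w \<in> space M" "d (fst j) w < snd j" "d (fst i) w < snd i"
        using j by (auto simp: F'_def qball_def)
      have sp: "fst i \<in> space M" "fst j \<in> space M" "y \<in> space M"
        using psubset.prems[OF i] psubset.prems[OF j(1)] y by (auto simp: qball_def)
      have "d w y < \<kappa> * (snd j + snd j)"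
        using triangle_less[of w "fst j" y "snd j" "snd j"] w y sp dist_sym[of "fst j" w] by (simp add: qball_def)
      also have "\<dots> \<le> \<kappa> * (snd i + snd i)"
        using imax[OF j(1)] kappa_ge_1 by (intro mult_left_mono) auto
      finally have "d (fst i) y < \<kappa> * (snd i + \<kappa> * (snd i + snd i))"
        using triangle_less[of "fst i" w y] w sp by auto
      then show "y \<in> B (fst i) (\<kappa> * (1 + 2 * \<kappa>) * snd i)"
        using sp by (simp add: qball_def algebra_simps)
    qed
    show ?thesis
    proof (intro exI[of _ "insert i G"] conjI)
      show "insert i G \<subseteq> F" using i G \<open>F' \<subset> F\<close> by auto
      show "disjoint_family_on (\<lambda>i. B (fst i) (snd i)) (insert i G)"
        using G(1,2) unfolding disjoint_family_on_def F'_def by blast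
      show "(\<Union>i\<in>F. B (fst i) (snd i)) \<subseteq> (\<Union>i\<in>insert i G. B (fst i) (\<kappa> * (1 + 2 * \<kappa>) * snd i))"
        using near G(3) by blast
    qed
  next
    case True
    then show ?thesis by (intro exI[of _ "{}"]) (simp add: disjoint_family_on_def)
  qed
qed

text \<open>The superlevel set is exactly the union of those balls of the family whose normalised
  integral of \<open>f\<close> exceeds \<open>l\<close>. Disjoint balls chosen from finitely many of
  them pay for the mass of their dilates with disjoint portions of the integral of
  \<open>f\<close>.\<close>

lemma maximal_weak_type:
  assumes f [measurable]: "f \<in> borel_measurable M" and l: "0 < l"
  shows "ennreal l * emeasure M {x \<in> space M. ennreal l < maximal f x}
      \<le> ennreal (A * (\<kappa> * (1 + 2 * \<kappa>)) powr \<eta>) * (\<integral>\<^sup>+y. f y \<partial>M)"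
proof -
  define K where "K = \<kappa> * (1 + 2 * \<kappa>)"
  have K: "0 < K" using kappa_ge_1 by (simp add: K_def)
  define S where "S = {i \<in> ball_indices. ennreal l <
    ennreal (snd i powr - \<eta>) * (\<integral>\<^sup>+y\<in>B (fst i) (snd i). f y \<partial>M)}"
  define I where "I = (\<integral>\<^sup>+y. f y \<partial>M)"
  have S_idx: "fst i \<in> space M \<and> 0 < snd i" if "i \<in> S" for i
    using that ball_indicesD by (auto simp: S_def)
  have eq: "{x \<in> space M. ennreal l < maximal f x} = (\<Union>i\<in>S. B (fst i) (snd i))"
  proof (intro set_eqI iffI)
    fix x assume "x \<in> {x \<in> space M. ennreal l < maximal f x}"
    then obtain c s where "(c, s) \<in> ball_indices"
      "ennreal l < ennreal (s powr - \<eta>) * (\<integral>\<^sup>+y\<in>B c s. f y \<partial>M) * indicator (B c s) x"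
      by (auto simp: maximal_def less_SUP_iff)
    then have "(c, s) \<in> S" "x \<in> B c s"
      by (cases "x \<in> B c s"; simp add: S_def)+
    then show "x \<in> (\<Union>i\<in>S. B (fst i) (snd i))" by force
  next
    fix x assume "x \<in> (\<Union>i\<in>S. B (fst i) (snd i))"
    then obtain c s where "(c, s) \<in> S" "x \<in> B c s" by auto
    then show "x \<in> {x \<in> space M. ennreal l < maximal f x}"
      using ball_subset_space unfolding maximal_def less_SUP_iff S_def
      by (auto intro!: bexI[of _ "(c, s)"])
  qed
  \<comment> \<open>The bound is uniform in \<open>F\<close>, so it survives exhausting the
    countable family by finite ones.\<close>
  have fin: "ennreal l * emeasure M (\<Union>i\<in>F. B (fst i) (snd i)) \<le> ennreal (A * K powr \<eta>) * I"
    if F: "finite F" "F \<subseteq> S" for F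
  proof -
    obtain G where G: "G \<subseteq> F" "disjoint_family_on (\<lambda>i. B (fst i) (snd i)) G"
      "(\<Union>i\<in>F. B (fst i) (snd i)) \<subseteq> (\<Union>i\<in>G. B (fst i) (K * snd i))"
      using vitali_finite[OF F(1)] S_idx F(2) unfolding K_def by (metis (no_types, lifting) subsetD)
    have GS: "i \<in> S" if "i \<in> G" for i using G F that by auto
    have finG: "finite G" using G(1) F(1) by (rule finite_subset)
    have "ennreal l * emeasure M (\<Union>i\<in>F. B (fst i) (snd i))
        \<le> ennreal l * emeasure M (\<Union>i\<in>G. B (fst i) (K * snd i))"
      using G(3) S_idx[OF GS] finG
      by (intro mult_left_mono emeasure_mono sets.finite_UN sets_ball) auto
    also have "\<dots> \<le> ennreal l * (\<Sum>i\<in>G. emeasure M (B (fst i) (K * snd i)))"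
      using S_idx[OF GS] finG by (intro mult_left_mono emeasure_subadditive_finite) auto
    also have "\<dots> = (\<Sum>i\<in>G. ennreal l * emeasure M (B (fst i) (K * snd i)))"
      by (simp add: sum_distrib_left)
    also have "\<dots> \<le> (\<Sum>i\<in>G. ennreal (A * K powr \<eta>) * (\<integral>\<^sup>+y\<in>B (fst i) (snd i). f y \<partial>M))"
    proof (rule sum_mono)
      fix i assume i: "i \<in> G"
      have i': "fst i \<in> space M" "0 < snd i" using S_idx GS i by auto
      \<comment> \<open>The factor \<open>snd i powr - \<eta>\<close> from membership in
        \<open>S\<close> cancels the radius in the upper mass bound of the dilated ball.\<close>
      have "ennreal l * emeasure M (B (fst i) (K * snd i))
          \<le> (ennreal (snd i powr - \<eta>) * (\<integral>\<^sup>+y\<in>B (fst i) (snd i). f y \<partial>M)) *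
            ennreal (A * (K * snd i) powr \<eta>)"
        using GS[OF i] i' K by (intro mult_mono ball_upper) (auto simp: S_def)
      also have "\<dots> = ennreal (A * K powr \<eta>) * (\<integral>\<^sup>+y\<in>B (fst i) (snd i). f y \<partial>M)"
      proof -
        have "ennreal (snd i powr - \<eta>) * ennreal (A * (K * snd i) powr \<eta>) = ennreal (A * K powr \<eta>)"
          using i' K A_pos by (simp add: ennreal_mult'[symmetric] powr_mult powr_minus field_simps)
        then show ?thesis unfolding \<open>ennreal (snd i powr - \<eta>) * _ = _\<close>[symmetric] by (simp only: ac_simps)
      qed
      finally show "ennreal l * emeasure M (B (fst i) (K * snd i))
        \<le> ennreal (A * K powr \<eta>) * (\<integral>\<^sup>+y\<in>B (fst i) (snd i). f y \<partial>M)" .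
    qed
    also have "\<dots> = ennreal (A * K powr \<eta>) * (\<Sum>i\<in>G. \<integral>\<^sup>+y\<in>B (fst i) (snd i). f y \<partial>M)"
      by (simp add: sum_distrib_left)
    also have "(\<Sum>i\<in>G. \<integral>\<^sup>+y\<in>B (fst i) (snd i). f y \<partial>M)
        = (\<integral>\<^sup>+y. (\<Sum>i\<in>G. f y * indicator (B (fst i) (snd i)) y) \<partial>M)"
      using GS S_idx by (subst nn_integral_sum) auto
    also have "\<dots> \<le> I"
      unfolding I_def
    proof (rule nn_integral_mono)
      fix y
      have "(\<Sum>i\<in>G. f y * indicator (B (fst i) (snd i)) y) =
          f y * indicator (\<Union>i\<in>G. B (fst i) (snd i)) y"
        unfolding indicator_UN_disjoint[OF finG G(2)] by (simp add: sum_distrib_left)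
      also have "\<dots> \<le> f y" by (auto simp: indicator_def)
      finally show "(\<Sum>i\<in>G. f y * indicator (B (fst i) (snd i)) y) \<le> f y" .
    qed
    finally show ?thesis by (simp add: mult_left_mono)
  qed
  show ?thesis
  proof (cases "S = {}")
    case True
    then show ?thesis by (simp add: eq)
  next
    case False
    have cS: "countable S"
      using countable_ball_indices by (rule countable_subset[rotated]) (auto simp: S_def)
    \<comment> \<open>\<open>from_nat_into\<close> enumerates a nonempty countable set, possibly
      with repetitions; hence the separate case \<open>S = {}\<close>.\<close>
    define E where "E n = (\<Union>i\<in>from_nat_into S ` {..n}. B (fst i) (snd i))" for n
    have sub: "from_nat_into S ` {..n} \<subseteq> S" for n using from_nat_into[OF False] by auto
    have E: "E n \<in> sets M" for n
      unfolding E_def using sub[of n] S_idx by (intro sets.finite_UN sets_ball) blast+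
    have "incseq E" by (force simp: incseq_def E_def)
    have "(\<Union>n. E n) = (\<Union>i\<in>range (from_nat_into S). B (fst i) (snd i))"
      unfolding E_def by auto
    then have "(\<Union>i\<in>S. B (fst i) (snd i)) = (\<Union>n. E n)"
      by (simp only: range_from_nat_into[OF False cS])
    then have "emeasure M (\<Union>i\<in>S. B (fst i) (snd i)) = (SUP n. emeasure M (E n))"
      using SUP_emeasure_incseq[of E M] E \<open>incseq E\<close> by (simp add: image_subset_iff)
    then have "ennreal l * emeasure M (\<Union>i\<in>S. B (fst i) (snd i)) =
        (SUP n. ennreal l * emeasure M (E n))"
      by (simp add: SUP_mult_left_ennreal)
    also have "\<dots> \<le> ennreal (A * K powr \<eta>) * I"
      unfolding E_def by (intro SUP_least fin sub) auto
    finally show ?thesis by (simp add: eq I_def K_def)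
  qed
qed

text \<open>The part of \<open>f\<close> below \<open>l / (2 * A)\<close> contributes at most \<open>l / 2\<close> to the maximal function.\<close>

lemma maximal_weak_type_truncated:
  assumes [measurable]: "f \<in> borel_measurable M" and l: "0 < l"
  shows "ennreal l * emeasure M {x \<in> space M. ennreal l < maximal f x}
    \<le> ennreal (2 * (A * (\<kappa> * (1 + 2 * \<kappa>)) powr \<eta>)) *
      (\<integral>\<^sup>+y. (if ennreal l < ennreal (2 * A) * f y then f y else 0) \<partial>M)"
proof -
  \<comment> \<open>The \<open>A\<close> in the threshold is the upper mass constant:
    \<open>l / (2 * A)\<close> integrated over a ball of radius \<open>s\<close> and multiplied by
    \<open>s powr - \<eta>\<close> is at most \<open>l / 2\<close>.\<close>
  define f1 where "f1 y = (if ennreal l < ennreal (2 * A) * f y then f y else 0)" for y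
  have [measurable]: "f1 \<in> borel_measurable M" unfolding f1_def[abs_def] by measurable
  have split: "f y \<le> f1 y + ennreal (l / (2 * A))" for y
  proof (cases "ennreal l < ennreal (2 * A) * f y")
    case False
    then show ?thesis
      using A_pos l by (cases "f y")
        (auto simp: f1_def ennreal_mult'[symmetric] ennreal_less_iff ennreal_mult_top field_simps
          simp del: ennreal_mult'' intro!: ennreal_leI)
  qed (simp add: f1_def)
  have imp: "ennreal (l / 2) < maximal f1 x" if x: "ennreal l < maximal f x" for x
  proof -
    obtain c s where cs: "(c, s) \<in> ball_indices"
      "ennreal l < ennreal (s powr - \<eta>) * (\<integral>\<^sup>+y\<in>B c s. f y \<partial>M) * indicator (B c s) x"
      using x by (auto simp: maximal_def less_SUP_iff)
    then have xB: "x \<in> B c s" by (cases "x \<in> B c s") auto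
    have csp: "c \<in> space M" and s: "0 < s" using ball_indicesD[OF cs(1)] by auto
    note [measurable] = sets_ball[OF csp, of s]
    have "(\<integral>\<^sup>+y\<in>B c s. f y \<partial>M) \<le> (\<integral>\<^sup>+y. f1 y * indicator (B c s) y +
        ennreal (l / (2 * A)) * indicator (B c s) y \<partial>M)"
      using split by (intro nn_integral_mono) (auto simp: indicator_def)
    also have "\<dots> = (\<integral>\<^sup>+y\<in>B c s. f1 y \<partial>M) + ennreal (l / (2 * A)) * emeasure M (B c s)"
      by (subst nn_integral_add) (auto simp: nn_integral_cmult_indicator)
    also have "\<dots> \<le> (\<integral>\<^sup>+y\<in>B c s. f1 y \<partial>M) + ennreal (l / (2 * A)) * ennreal (A * s powr \<eta>)"
      by (intro add_left_mono mult_left_mono ball_upper csp s) auto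
    also have "ennreal (l / (2 * A)) * ennreal (A * s powr \<eta>) = ennreal (l / 2 * s powr \<eta>)"
      using A_pos l by (simp add: ennreal_mult'[symmetric])
    finally have "ennreal (s powr - \<eta>) * (\<integral>\<^sup>+y\<in>B c s. f y \<partial>M)
      \<le> ennreal (s powr - \<eta>) * ((\<integral>\<^sup>+y\<in>B c s. f1 y \<partial>M) + ennreal (l / 2 * s powr \<eta>))"
      by (intro mult_left_mono) auto
    also have "\<dots> = ennreal (s powr - \<eta>) * (\<integral>\<^sup>+y\<in>B c s. f1 y \<partial>M) + ennreal (l / 2)"
      using s l by (simp add: distrib_left ennreal_mult'[symmetric] powr_minus)
    finally have *: "ennreal l < ennreal (s powr - \<eta>) * (\<integral>\<^sup>+y\<in>B c s. f1 y \<partial>M) + ennreal (l / 2)"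
      using cs(2) xB by simp
    have "ennreal (l / 2) < ennreal (s powr - \<eta>) * (\<integral>\<^sup>+y\<in>B c s. f1 y \<partial>M)" (is "_ < ?X")
    proof (rule ccontr)
      assume "\<not> ennreal (l / 2) < ?X"
      then have "?X + ennreal (l / 2) \<le> ennreal (l / 2) + ennreal (l / 2)"
        by (intro add_right_mono) simp
      also have "\<dots> = ennreal l" using l by (simp flip: ennreal_plus)
      finally show False using * by simp
    qed
    also have "?X \<le> maximal f1 x"
      unfolding maximal_def using cs(1) xB by (intro SUP_upper2[of "(c, s)"]) auto
    finally show ?thesis .
  qed
  \<comment> \<open>Writing \<open>l\<close> as twice the level \<open>l / 2\<close>, at which the
    weak type bound is applied to \<open>f1\<close>, is the origin of the factor 2 in the
    constant.\<close>
  have "ennreal l * emeasure M {x \<in> space M. ennreal l < maximal f x}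
      \<le> (2 * ennreal (l / 2)) * emeasure M {x \<in> space M. ennreal (l / 2) < maximal f1 x}"
    using imp l by (intro mult_mono emeasure_mono) (auto simp: ennreal_mult'[symmetric] simp flip: ennreal_numeral)
  also have "\<dots> \<le> 2 * (ennreal (A * (\<kappa> * (1 + 2 * \<kappa>)) powr \<eta>) * (\<integral>\<^sup>+y. f1 y \<partial>M))"
    unfolding mult.assoc using l by (intro mult_left_mono maximal_weak_type) auto
  also have "\<dots> = ennreal (2 * (A * (\<kappa> * (1 + 2 * \<kappa>)) powr \<eta>)) * (\<integral>\<^sup>+y. f1 y \<partial>M)"
    using A_pos by (simp add: ennreal_mult' mult.assoc)
  finally show ?thesis by (simp add: f1_def)
qed

text \<open>Interpolation by hand: the truncated weak type bound enters the layer cake formula, and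
  after exchanging integrals the inner one is that of \<open>t powr (p - 2)\<close> up to
  \<open>2 * A * f y\<close>. It converges at 0 because \<open>1 < p\<close>, and the remaining
  factor \<open>f y\<close> restores the power \<open>p\<close>.\<close>

lemma maximal_strong_type:
  assumes p: "1 < p"
  shows "\<exists>C>0. \<forall>f\<in>borel_measurable M.
    (\<integral>\<^sup>+x. ennreal_powr (maximal f x) p \<partial>M) \<le> ennreal C * (\<integral>\<^sup>+x. ennreal_powr (f x) p \<partial>M)"
proof -
  interpret sigma_finite_measure M by (rule sigma_finite)
  interpret P: pair_sigma_finite M lborel
    by (intro pair_sigma_finite.intro sigma_finite_measure_axioms lborel.sigma_finite_measure_axioms)
  define W where "W = 2 * (A * (\<kappa> * (1 + 2 * \<kappa>)) powr \<eta>)"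
  have W: "0 < W" using A_pos kappa_ge_1 by (simp add: W_def)
  \<comment> \<open>\<open>Q * v powr (p - 1)\<close> is the integral of
    \<open>t powr (p - 2)\<close> over \<open>0 < t < 2 * A * v\<close>.\<close>
  define Q where "Q = 1 / (p - 1) * (2 * A) powr (p - 1)"
  have Q: "0 < Q" using A_pos p by (simp add: Q_def)
  have "0 \<le> 2 * A" "0 \<le> 1 / (p - 1)" using A_pos p by simp_all
  then have eQ: "ennreal Q = ennreal (1 / (p - 1)) * ennreal_powr (ennreal (2 * A)) (p - 1)"
    by (simp only: Q_def ennreal_powr_ennreal ennreal_mult'[of "1 / (p - 1)"])
  define C where "C = p * (W * Q)"
  show ?thesis
  proof (intro exI[of _ C] conjI ballI)
    show "0 < C" using W Q p by (simp add: C_def)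
    fix f :: "'a \<Rightarrow> ennreal" assume f [measurable]: "f \<in> borel_measurable M"
    define h where "h t y = (if 0 < t \<and> ennreal t < ennreal (2 * A) * f y
      then ennreal (t powr (p - 1 - 1)) else 0)" for t y
    have h: "(\<lambda>(y, t). f y * h t y) \<in> borel_measurable (M \<Otimes>\<^sub>M lborel)"
      unfolding h_def by measurable
    have hy [measurable]: "(\<lambda>t. h t y) \<in> borel_measurable lborel" for y
      unfolding h_def by measurable
    have "(\<integral>\<^sup>+x. ennreal_powr (maximal f x) p \<partial>M) = ennreal p *
       (\<integral>\<^sup>+t. (if 0 < t then ennreal (t powr (p - 1)) * emeasure M {x \<in> space M. ennreal t < maximal f x} else 0) \<partial>lborel)"
      using p by (intro nn_integral_layer_cake) auto
    also have "\<dots> \<le> ennreal p * (\<integral>\<^sup>+t. ennreal W * (\<integral>\<^sup>+y. f y * h t y \<partial>M) \<partial>lborel)"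
    proof (intro mult_left_mono nn_integral_mono)
      fix t :: real
      show "(if 0 < t then ennreal (t powr (p - 1)) * emeasure M {x \<in> space M. ennreal t < maximal f x} else 0)
        \<le> ennreal W * (\<integral>\<^sup>+y. f y * h t y \<partial>M)"
      proof (cases "0 < t")
        case True
        \<comment> \<open>One factor \<open>t\<close> is split off to form the left-hand side of the
          weak type bound at level \<open>t\<close>.\<close>
        have "ennreal (t powr (p - 1)) = ennreal (t powr (p - 1 - 1)) * ennreal t"
          using True powr_add[of t "p - 1 - 1" 1] by (simp add: ennreal_mult'[symmetric])
        then have "ennreal (t powr (p - 1)) * emeasure M {x \<in> space M. ennreal t < maximal f x}
          = ennreal (t powr (p - 1 - 1)) * (ennreal t * emeasure M {x \<in> space M. ennreal t < maximal f x})"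
          by (simp add: mult.assoc)
        also have "\<dots> \<le> ennreal (t powr (p - 1 - 1)) *
            (ennreal W * (\<integral>\<^sup>+y. (if ennreal t < ennreal (2 * A) * f y then f y else 0) \<partial>M))"
          unfolding W_def by (intro mult_left_mono maximal_weak_type_truncated True f) auto
        also have "\<dots> = ennreal W * (\<integral>\<^sup>+y. ennreal (t powr (p - 1 - 1)) *
            (if ennreal t < ennreal (2 * A) * f y then f y else 0) \<partial>M)"
          by (subst nn_integral_cmult) (auto simp: mult.left_commute)
        also have "(\<integral>\<^sup>+y. ennreal (t powr (p - 1 - 1)) *
            (if ennreal t < ennreal (2 * A) * f y then f y else 0) \<partial>M) = (\<integral>\<^sup>+y. f y * h t y \<partial>M)"
          using True by (intro nn_integral_cong) (auto simp: h_def mult.commute)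
        finally show ?thesis using True by simp
      qed simp
    qed simp
    also have "\<dots> = ennreal p * (ennreal W * (\<integral>\<^sup>+t. (\<integral>\<^sup>+y. f y * h t y \<partial>M) \<partial>lborel))"
      using borel_measurable_nn_integral_fst[of "\<lambda>(t, y). f y * h t y" lborel]
        measurable_pair_swap[OF h] by (subst nn_integral_cmult) (auto simp: split_beta')
    also have "(\<integral>\<^sup>+t. (\<integral>\<^sup>+y. f y * h t y \<partial>M) \<partial>lborel) = (\<integral>\<^sup>+y. (\<integral>\<^sup>+t. f y * h t y \<partial>lborel) \<partial>M)"
      by (rule P.Fubini'[OF h])
    also have "\<dots> = (\<integral>\<^sup>+y. ennreal Q * ennreal_powr (f y) p \<partial>M)"
    proof (rule nn_integral_cong)
      fix y
      have "(\<integral>\<^sup>+t. f y * h t y \<partial>lborel) = f y * (\<integral>\<^sup>+t. h t y \<partial>lborel)"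
        by (rule nn_integral_cmult) measurable
      also have "(\<integral>\<^sup>+t. h t y \<partial>lborel) = ennreal (1 / (p - 1)) * ennreal_powr (ennreal (2 * A) * f y) (p - 1)"
        using p unfolding h_def by (intro nn_integral_powr_below) simp
      also have "\<dots> = ennreal Q * ennreal_powr (f y) (p - 1)"
        by (simp only: eQ ennreal_powr_mult mult.assoc)
      also have "f y * \<dots> = ennreal Q *
          (ennreal_powr (f y) 1 * ennreal_powr (f y) (p - 1))"
        by (simp only: ennreal_powr_1 ac_simps)
      also have "ennreal_powr (f y) 1 * ennreal_powr (f y) (p - 1) = ennreal_powr (f y) p"
        using ennreal_powr_add[of 1 "p - 1" "f y"] p by simp
      finally show "(\<integral>\<^sup>+t. f y * h t y \<partial>lborel) =
        ennreal Q * ennreal_powr (f y) p" .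
    qed
    also have "\<dots> = ennreal Q * (\<integral>\<^sup>+y. ennreal_powr (f y) p \<partial>M)"
      by (rule nn_integral_cmult) measurable
    finally show "(\<integral>\<^sup>+x. ennreal_powr (maximal f x) p \<partial>M) \<le> ennreal C * (\<integral>\<^sup>+x. ennreal_powr (f x) p \<partial>M)"
      using W p by (simp add: C_def ennreal_mult' mult.assoc)
  qed
qed

section \<open>Fractional integrals\<close>

text \<open>Hoelder's inequality on a ball, obtained from \<open>le_add_powr\<close>; it will govern
  the large radii.\<close>

lemma ball_integral_le_powr:
  assumes f [measurable]: "f \<in> borel_measurable M" and p: "1 \<le> p" and x: "x \<in> space M" and r: "0 < r"
    and le1: "(\<integral>\<^sup>+y. ennreal_powr (f y) p \<partial>M) \<le> 1"
  shows "(\<integral>\<^sup>+y\<in>B x r. f y \<partial>M) \<le> ennreal ((A + 1) * r powr (\<eta> - \<eta> / p))"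
proof -
  note [measurable] = sets_ball[OF x, of r]
  \<comment> \<open>This level balances the two terms: \<open>t * r powr \<eta>\<close> and
    \<open>t powr (1 - p)\<close> both equal \<open>r powr (\<eta> - \<eta> / p)\<close>.\<close>
  define t where "t = r powr (- \<eta> / p)"
  have t: "0 < t" using r by (simp add: t_def)
  have "(\<integral>\<^sup>+y\<in>B x r. f y \<partial>M) \<le>
    (\<integral>\<^sup>+y. ennreal t * indicator (B x r) y + ennreal (t powr (1 - p)) * ennreal_powr (f y) p \<partial>M)"
    using le_add_powr[OF t p] by (intro nn_integral_mono) (auto simp: indicator_def)
  also have "\<dots> = ennreal t * emeasure M (B x r) +
      ennreal (t powr (1 - p)) * (\<integral>\<^sup>+y. ennreal_powr (f y) p \<partial>M)"
    by (subst nn_integral_add) (auto simp: nn_integral_cmult_indicator nn_integral_cmult)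
  also have "\<dots> \<le> ennreal t * ennreal (A * r powr \<eta>) + ennreal (t powr (1 - p)) * 1"
    by (intro add_mono mult_left_mono ball_upper x r le1) auto
  also have "\<dots> = ennreal (A * (t * r powr \<eta>) + t powr (1 - p))"
    using t A_pos by (simp add: ennreal_mult'[symmetric] mult_ac flip: ennreal_plus)
  also have "t * r powr \<eta> = r powr (\<eta> - \<eta> / p)"
    by (simp add: t_def add.commute flip: powr_add)
  also have "t powr (1 - p) = r powr (\<eta> - \<eta> / p)"
  proof -
    have "- \<eta> / p * (1 - p) = \<eta> - \<eta> / p" using p by (simp add: field_simps)
    then show ?thesis by (simp only: t_def powr_powr)
  qed
  finally show ?thesis by (simp add: algebra_simps)
qed

text \<open>The linear fractional integral, used with \<open>g = \<eta> * (1 - \<alpha>)\<close>,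
  for which the reciprocal exponent drops from \<open>1 / p\<close> to
  \<open>1 / p - \<alpha>\<close>. Since \<open>inverse 0 = top\<close>, the kernel is infinite at
  \<open>y = x\<close>.\<close>

definition riesz :: "real \<Rightarrow> ('a \<Rightarrow> ennreal) \<Rightarrow> 'a \<Rightarrow> ennreal" where
  "riesz g f x = (\<integral>\<^sup>+y. f y * inverse (ennreal (d x y powr g)) \<partial>M)"

text \<open>Expanding the kernel by \<open>nn_integral_powr_above\<close> and exchanging integrals
  leaves only integrals of \<open>f\<close> over balls, which both the maximal function and the norm
  control.\<close>

lemma riesz_eq_integral_over_balls:
  assumes f [measurable]: "f \<in> borel_measurable M" and g: "0 < g" and x: "x \<in> space M"
  shows "riesz g f x = ennreal g *
    (\<integral>\<^sup>+t. (if 0 < t then ennreal (t powr (- g - 1)) * (\<integral>\<^sup>+y\<in>B x t. f y \<partial>M) else 0) \<partial>lborel)"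
proof -
  interpret sigma_finite_measure M by (rule sigma_finite)
  interpret P: pair_sigma_finite M lborel
    by (intro pair_sigma_finite.intro sigma_finite_measure_axioms lborel.sigma_finite_measure_axioms)
  note [measurable] = dist_measurable[OF x] sets_ball[OF x]
  define h where "h y t = (if d x y < t then ennreal (t powr (- g - 1)) else 0)" for y and t :: real
  have hm: "(\<lambda>(y, t). f y * h y t) \<in> borel_measurable (M \<Otimes>\<^sub>M lborel)"
    unfolding h_def by measurable
  have hy [measurable]: "(\<lambda>t. h y t) \<in> borel_measurable lborel" for y
    unfolding h_def by measurable
  have "riesz g f x = (\<integral>\<^sup>+y. ennreal g * (\<integral>\<^sup>+t. f y * h y t \<partial>lborel) \<partial>M)"
    unfolding riesz_def
  proof (rule nn_integral_cong)
    fix y assume y: "y \<in> space M"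
    have "inverse (ennreal (d x y powr g)) = ennreal g * (\<integral>\<^sup>+t. h y t \<partial>lborel)"
      using g dist_nonneg[OF x y] unfolding h_def
      by (simp add: nn_integral_powr_above ennreal_mult'[symmetric] mult.assoc[symmetric])
    then show "f y * inverse (ennreal (d x y powr g)) = ennreal g * (\<integral>\<^sup>+t. f y * h y t \<partial>lborel)"
      by (simp add: nn_integral_cmult mult.left_commute)
  qed
  also have "\<dots> = ennreal g * (\<integral>\<^sup>+y. (\<integral>\<^sup>+t. f y * h y t \<partial>lborel) \<partial>M)"
    using lborel.borel_measurable_nn_integral_fst[OF hm]
    by (intro nn_integral_cmult) simp
  also have "(\<integral>\<^sup>+y. (\<integral>\<^sup>+t. f y * h y t \<partial>lborel) \<partial>M) = (\<integral>\<^sup>+t. (\<integral>\<^sup>+y. f y * h y t \<partial>M) \<partial>lborel)"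
    by (rule P.Fubini'[OF hm, symmetric])
  also have "\<dots> = (\<integral>\<^sup>+t. (if 0 < t then ennreal (t powr (- g - 1)) * (\<integral>\<^sup>+y\<in>B x t. f y \<partial>M) else 0) \<partial>lborel)"
  proof (rule nn_integral_cong)
    fix t :: real
    have "(\<integral>\<^sup>+y. f y * h y t \<partial>M) = (\<integral>\<^sup>+y. ennreal (t powr (- g - 1)) * (f y * indicator (B x t) y) \<partial>M)"
      by (intro nn_integral_cong) (auto simp: h_def qball_def indicator_def mult.commute)
    also have "\<dots> = ennreal (t powr (- g - 1)) * (\<integral>\<^sup>+y\<in>B x t. f y \<partial>M)"
      by (intro nn_integral_cmult) measurable
    \<comment> \<open>Balls of nonpositive radius are empty, so restricting to \<open>0 < t\<close>
      loses nothing.\<close>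
    also have "B x t = {}" if "\<not> 0 < t"
      using that dist_nonneg[OF x] by (force simp: qball_def)
    then have "ennreal (t powr (- g - 1)) * (\<integral>\<^sup>+y\<in>B x t. f y \<partial>M) =
      (if 0 < t then ennreal (t powr (- g - 1)) * (\<integral>\<^sup>+y\<in>B x t. f y \<partial>M) else 0)" by auto
    finally show "(\<integral>\<^sup>+y. f y * h y t \<partial>M) =
      (if 0 < t then ennreal (t powr (- g - 1)) * (\<integral>\<^sup>+y\<in>B x t. f y \<partial>M) else 0)" .
  qed
  finally show ?thesis .
qed

text \<open>With \<open>b = \<eta> * (1 / p - \<alpha>)\<close>, radii below \<open>R\<close> lead
  to \<open>t powr (\<eta> * \<alpha> - 1)\<close> times the maximal function, radii above to
  \<open>t powr (- b - 1)\<close>. Convergence at 0 is \<open>0 < \<alpha>\<close>, convergence at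
  infinity is \<open>\<alpha> < 1 / p\<close>.\<close>

lemma riesz_le_split:
  assumes p: "1 < p" and al: "0 < \<alpha>" "\<alpha> < 1 / p"
  shows "\<exists>C>0. \<forall>f\<in>borel_measurable M. (\<integral>\<^sup>+y. ennreal_powr (f y) p \<partial>M) \<le> 1 \<longrightarrow>
    (\<forall>x\<in>space M. \<forall>R>0. riesz (\<eta> * (1 - \<alpha>)) f x \<le> ennreal C *
      (ennreal (R powr (\<eta> * \<alpha>)) * maximal f x + ennreal (R powr - (\<eta> * (1 / p - \<alpha>)))))"
proof -
  define g where "g = \<eta> * (1 - \<alpha>)"
  define b where "b = \<eta> * (1 / p - \<alpha>)"
  have "1 / p < 1" using p by simp
  with al eta_pos have g: "0 < g" by (simp add: g_def)
  have b: "0 < b" using al eta_pos by (simp add: b_def)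
  have ea: "0 < \<eta> * \<alpha>" using al eta_pos by simp
  define C1 where "C1 = (4 * \<kappa>) powr \<eta> * (1 / (\<eta> * \<alpha>))"
  define C2 where "C2 = (A + 1) * (1 / b)"
  have C1: "0 < C1" using kappa_ge_1 ea by (simp add: C1_def)
  have C2: "0 < C2" using A_pos b by (simp add: C2_def)
  show ?thesis
  proof (intro exI[of _ "g * (C1 + C2)"] conjI ballI impI allI)
    show "0 < g * (C1 + C2)" using g C1 C2 by simp
    fix f :: "'a \<Rightarrow> ennreal" and x R
    assume f [measurable]: "f \<in> borel_measurable M" and le1: "(\<integral>\<^sup>+y. ennreal_powr (f y) p \<partial>M) \<le> 1"
      and x: "x \<in> space M" and R: "0 < (R::real)"
    let ?m = "maximal f x"
    define H1 where "H1 t = (if 0 < t \<and> ennreal t < ennreal R then ennreal (t powr (\<eta> * \<alpha> - 1)) else 0)" for t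
    define H2 where "H2 t = (if R < t then ennreal (t powr (- b - 1)) else 0)" for t
    have [measurable]: "H1 \<in> borel_measurable lborel" "H2 \<in> borel_measurable lborel"
      unfolding H1_def[abs_def] H2_def[abs_def] by measurable
    \<comment> \<open>Both \<open>H1\<close> and \<open>H2\<close> vanish at \<open>t = R\<close>,
      so this one radius, a null set, is left out.\<close>
    have ptw: "(if 0 < t then ennreal (t powr (- g - 1)) * (\<integral>\<^sup>+y\<in>B x t. f y \<partial>M) else 0)
      \<le> (ennreal ((4 * \<kappa>) powr \<eta>) * ?m) * H1 t + ennreal (A + 1) * H2 t" if tR: "t \<noteq> R" for t
    proof (cases "0 < t")
      case t: True
      show ?thesis
      proof (cases "t < R")
        case True
        have "ennreal (t powr (- g - 1)) * (\<integral>\<^sup>+y\<in>B x t. f y \<partial>M)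
            \<le> ennreal (t powr (- g - 1)) * (ennreal ((4 * \<kappa> * t) powr \<eta>) * ?m)"
          by (intro mult_left_mono ball_integral_le_maximal x t) simp
        also have "\<dots> = ennreal (t powr (- g - 1) * (4 * \<kappa> * t) powr \<eta>) * ?m"
          by (simp add: ennreal_mult' mult.assoc)
        also have "t powr (- g - 1) * (4 * \<kappa> * t) powr \<eta> = (4 * \<kappa>) powr \<eta> * (t powr (- g - 1) * t powr \<eta>)"
          using kappa_ge_1 t by (simp add: powr_mult)
        also have "t powr (- g - 1) * t powr \<eta> = t powr (\<eta> * \<alpha> - 1)"
          by (simp add: g_def algebra_simps flip: powr_add)
        finally show ?thesis using t True
          by (simp add: H1_def H2_def ennreal_less_iff ennreal_mult' ac_simps)
      next
        case False
        with tR have Rt: "R < t" by simp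
        have "ennreal (t powr (- g - 1)) * (\<integral>\<^sup>+y\<in>B x t. f y \<partial>M)
            \<le> ennreal (t powr (- g - 1)) * ennreal ((A + 1) * t powr (\<eta> - \<eta> / p))"
          using p by (intro mult_left_mono ball_integral_le_powr x t f le1) auto
        also have "\<dots> = ennreal ((A + 1) * (t powr (- g - 1) * t powr (\<eta> - \<eta> / p)))"
          by (simp add: ennreal_mult'[symmetric] ac_simps)
        also have "t powr (- g - 1) * t powr (\<eta> - \<eta> / p) = t powr (- b - 1)"
          by (simp add: g_def b_def algebra_simps flip: powr_add)
        finally show ?thesis using t Rt A_pos
          by (simp add: H1_def H2_def ennreal_less_iff ennreal_mult')
      qed
    qed simp
    have "riesz g f x \<le> ennreal g *
      (\<integral>\<^sup>+t. (ennreal ((4 * \<kappa>) powr \<eta>) * ?m) * H1 t + ennreal (A + 1) * H2 t \<partial>lborel)"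
      unfolding riesz_eq_integral_over_balls[OF f g x]
    proof (intro mult_left_mono nn_integral_mono_AE)
      show "AE t in lborel. (if 0 < t then ennreal (t powr (- g - 1)) * (\<integral>\<^sup>+y\<in>B x t. f y \<partial>M) else 0)
        \<le> (ennreal ((4 * \<kappa>) powr \<eta>) * ?m) * H1 t + ennreal (A + 1) * H2 t"
        using AE_lborel_singleton[of R] by eventually_elim (rule ptw)
    qed simp
    also have "(\<integral>\<^sup>+t. (ennreal ((4 * \<kappa>) powr \<eta>) * ?m) * H1 t + ennreal (A + 1) * H2 t \<partial>lborel)
      = (ennreal ((4 * \<kappa>) powr \<eta>) * ?m) * (\<integral>\<^sup>+t. H1 t \<partial>lborel) + ennreal (A + 1) * (\<integral>\<^sup>+t. H2 t \<partial>lborel)"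
      by (simp add: nn_integral_add nn_integral_cmult)
    also have "(\<integral>\<^sup>+t. H1 t \<partial>lborel) = ennreal (1 / (\<eta> * \<alpha>)) * ennreal (R powr (\<eta> * \<alpha>))"
      unfolding H1_def using R ea by (simp add: nn_integral_powr_below ennreal_powr_ennreal)
    also have "(\<integral>\<^sup>+t. H2 t \<partial>lborel) = ennreal (1 / b) * ennreal (R powr - b)"
      unfolding H2_def using R b
      by (simp add: nn_integral_powr_above inverse_ennreal powr_minus)
    also have "ennreal ((4 * \<kappa>) powr \<eta>) * ?m * (ennreal (1 / (\<eta> * \<alpha>)) * ennreal (R powr (\<eta> * \<alpha>)))
      = ennreal C1 * (ennreal (R powr (\<eta> * \<alpha>)) * ?m)"
      unfolding C1_def ennreal_mult'[OF powr_ge_zero] by (simp only: ac_simps)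
    also have "ennreal (A + 1) * (ennreal (1 / b) * ennreal (R powr - b)) = ennreal C2 * ennreal (R powr - b)"
      unfolding C2_def using A_pos by (simp only: ennreal_mult' mult.assoc)
    also have "ennreal g * (ennreal C1 * (ennreal (R powr (\<eta> * \<alpha>)) * ?m) + ennreal C2 * ennreal (R powr - b))
      \<le> ennreal g * (ennreal (C1 + C2) * (ennreal (R powr (\<eta> * \<alpha>)) * ?m) + ennreal (C1 + C2) * ennreal (R powr - b))"
      using C1 C2 by (intro mult_left_mono add_mono mult_right_mono ennreal_leI) auto
    also have "\<dots> = ennreal (g * (C1 + C2)) * (ennreal (R powr (\<eta> * \<alpha>)) * ?m + ennreal (R powr - b))"
      unfolding ennreal_mult'[OF less_imp_le[OF g]] by (simp only: distrib_left mult.assoc)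
    finally show "riesz (\<eta> * (1 - \<alpha>)) f x \<le> ennreal (g * (C1 + C2)) *
      (ennreal (R powr (\<eta> * \<alpha>)) * maximal f x + ennreal (R powr - (\<eta> * (1 / p - \<alpha>))))"
      by (simp add: g_def b_def)
  qed
qed

text \<open>The Hardy-Littlewood-Sobolev estimate in a form that can be multiplied: instead of a
  norm bound with exponent \<open>1 / (1 / p - \<alpha>)\<close>, it supplies a pointwise majorant.
  The witness \<open>u\<close> is the \<open>p\<close>-th power of the maximal function of the
  normalised \<open>f\<close>.\<close>

lemma riesz_bound:
  assumes p: "1 < p" and al: "0 < \<alpha>" "\<alpha> < 1 / p"
  shows "\<exists>C>0. \<forall>f\<in>borel_measurable M. Lp_size M p f \<noteq> 0 \<longrightarrow> Lp_size M p f \<noteq> top \<longrightarrow>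
    (\<exists>u\<in>borel_measurable M. (\<integral>\<^sup>+x. u x \<partial>M) \<le> ennreal C \<and>
      (\<forall>x\<in>space M. riesz (\<eta> * (1 - \<alpha>)) f x \<le>
        ennreal C * Lp_size M p f * ennreal_powr (u x) (1 / p - \<alpha>)))"
proof -
  obtain C1 where C1: "0 < C1" and split: "\<And>f x R. f \<in> borel_measurable M \<Longrightarrow>
    (\<integral>\<^sup>+y. ennreal_powr (f y) p \<partial>M) \<le> 1 \<Longrightarrow> x \<in> space M \<Longrightarrow> 0 < R \<Longrightarrow>
    riesz (\<eta> * (1 - \<alpha>)) f x \<le> ennreal C1 *
      (ennreal (R powr (\<eta> * \<alpha>)) * maximal f x + ennreal (R powr - (\<eta> * (1 / p - \<alpha>))))"
    using riesz_le_split[OF assms] by blast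
  obtain C2 where C2: "0 < C2" and strong: "\<And>f. f \<in> borel_measurable M \<Longrightarrow>
    (\<integral>\<^sup>+x. ennreal_powr (maximal f x) p \<partial>M) \<le> ennreal C2 * (\<integral>\<^sup>+x. ennreal_powr (f x) p \<partial>M)"
    using maximal_strong_type[OF p] by blast
  show ?thesis
  proof (intro exI[of _ "2 * C1 + C2"] conjI ballI impI)
    show "0 < 2 * C1 + C2" using C1 C2 by simp
    fix f :: "'a \<Rightarrow> ennreal"
    assume f [measurable]: "f \<in> borel_measurable M" and F: "Lp_size M p f \<noteq> 0" "Lp_size M p f \<noteq> top"
    obtain r where r: "Lp_size M p f = ennreal r" "0 < r"
      using F by (cases "Lp_size M p f") (auto simp: less_le)
    have "(\<integral>\<^sup>+x. ennreal_powr (f x) p \<partial>M) = ennreal_powr (Lp_size M p f) p"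
      using p by (simp add: Lp_size_def ennreal_powr_powr ennreal_powr_1)
    then have J: "(\<integral>\<^sup>+x. ennreal_powr (f x) p \<partial>M) = ennreal (r powr p)"
      using r by (simp add: ennreal_powr_ennreal)
    \<comment> \<open>\<open>riesz_le_split\<close> asks for a normalised function, and only a
      finite nonzero norm can be divided out.\<close>
    define h where "h y = ennreal (1 / r) * f y" for y
    have h [measurable]: "h \<in> borel_measurable M" unfolding h_def[abs_def] by measurable
    have fh: "f y = ennreal r * h y" for y
      using r by (simp add: h_def mult.assoc[symmetric] ennreal_mult'[symmetric])
    have "(\<integral>\<^sup>+y. ennreal_powr (h y) p \<partial>M) = ennreal ((1 / r) powr p) * ennreal (r powr p)"
      using r by (simp add: h_def ennreal_powr_mult ennreal_powr_ennreal nn_integral_cmult J)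
    also have "\<dots> = 1" using r by (simp add: ennreal_mult'[symmetric] powr_divide)
    finally have h1: "(\<integral>\<^sup>+y. ennreal_powr (h y) p \<partial>M) = 1" .
    define u where "u x = ennreal_powr (maximal h x) p" for x
    show "\<exists>u\<in>borel_measurable M. (\<integral>\<^sup>+x. u x \<partial>M) \<le> ennreal (2 * C1 + C2) \<and>
      (\<forall>x\<in>space M. riesz (\<eta> * (1 - \<alpha>)) f x \<le>
        ennreal (2 * C1 + C2) * Lp_size M p f * ennreal_powr (u x) (1 / p - \<alpha>))"
    proof (intro bexI[of _ u] conjI ballI)
      show "u \<in> borel_measurable M" unfolding u_def[abs_def] by measurable
      have "(\<integral>\<^sup>+x. u x \<partial>M) \<le> ennreal C2" using strong[OF h] by (simp add: h1 u_def)
      also have "\<dots> \<le> ennreal (2 * C1 + C2)" using C1 by (intro ennreal_leI) simp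
      finally show "(\<integral>\<^sup>+x. u x \<partial>M) \<le> ennreal (2 * C1 + C2)" .
      fix x assume x: "x \<in> space M"
      note [measurable] = dist_measurable[OF x]
      have "riesz (\<eta> * (1 - \<alpha>)) f x = ennreal r * riesz (\<eta> * (1 - \<alpha>)) h x"
        unfolding riesz_def fh mult.assoc by (intro nn_integral_cmult) measurable
      also have "riesz (\<eta> * (1 - \<alpha>)) h x \<le> ennreal (2 * C1) *
          ennreal_powr (maximal h x) (\<eta> * (1 / p - \<alpha>) / (\<eta> * \<alpha> + \<eta> * (1 / p - \<alpha>)))"
        using al eta_pos C1 h1 x by (intro le_powr_if_le_balanced_sum split h) auto
      \<comment> \<open>The two exponents add up to \<open>\<eta> / p\<close>, so the balanced
        exponent becomes \<open>p * (1 / p - \<alpha>)\<close>, a power of \<open>u\<close>.\<close>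
      also have "\<eta> * (1 / p - \<alpha>) / (\<eta> * \<alpha> + \<eta> * (1 / p - \<alpha>)) = p * (1 / p - \<alpha>)"
        using eta_pos p by (simp add: field_simps)
      also have "ennreal_powr (maximal h x) (p * (1 / p - \<alpha>)) = ennreal_powr (u x) (1 / p - \<alpha>)"
        by (simp add: u_def ennreal_powr_powr)
      finally have "riesz (\<eta> * (1 - \<alpha>)) f x \<le>
          ennreal r * (ennreal (2 * C1) * ennreal_powr (u x) (1 / p - \<alpha>))"
        by (simp add: mult_left_mono)
      also have "\<dots> \<le> ennreal r * (ennreal (2 * C1 + C2) * ennreal_powr (u x) (1 / p - \<alpha>))"
        using C2 by (intro mult_left_mono mult_right_mono ennreal_leI) auto
      finally show "riesz (\<eta> * (1 - \<alpha>)) f x \<le>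
        ennreal (2 * C1 + C2) * Lp_size M p f * ennreal_powr (u x) (1 / p - \<alpha>)"
        by (simp add: r(1) ac_simps)
    qed
  qed
qed

section \<open>From the hypermetric to a product of linear potentials\<close>

text \<open>Every competitor \<open>u\<close> in the infimum is an intermediate point on the way
  from \<open>x\<close> to \<open>y\<close> and to \<open>z\<close>, so one triangle inequality
  bounds each distance by \<open>2 * \<kappa>\<close> times the maximum.\<close>

lemma max_dist_le_hypermetric3:
  assumes x: "x \<in> space M" and y: "y \<in> space M" and z: "z \<in> space M"
  shows "max (d x y) (d x z) / (2 * \<kappa>) \<le> hypermetric3 (space M) d x y z"
  unfolding hypermetric3_def
proof (rule cINF_greatest)
  fix u assume u: "u \<in> space M"
  let ?m = "Max {d x u, d y u, d z u}"
  have *: "d x w \<le> 2 * \<kappa> * ?m" if w: "w \<in> {y, z}" for w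
  proof -
    have wsp: "w \<in> space M" using w y z by auto
    have "d x w \<le> \<kappa> * (d x u + d u w)" by (rule dist_triangle[OF x u wsp])
    also have "\<dots> \<le> \<kappa> * (?m + ?m)"
      using kappa_ge_1 dist_sym[OF u wsp] w by (intro mult_left_mono add_mono) auto
    finally show ?thesis by simp
  qed
  show "max (d x y) (d x z) / (2 * \<kappa>) \<le> ?m"
    using *[of y] *[of z] kappa_ge_1 by (simp add: divide_le_eq mult.commute)
qed (use x in auto)

text \<open>Each distance separately is at most \<open>2 * \<kappa>\<close> times the hypermetric,
  so the exponent can be split between them at will. If a distance vanishes, the right-hand side is
  \<open>top\<close>, the other inverse being nonzero.\<close>

lemma inverse_hypermetric3_powr_le:
  assumes x: "x \<in> space M" and y: "y \<in> space M" and z: "z \<in> space M" and g: "0 < g1" "0 < g2"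
  shows "inverse (ennreal (hypermetric3 (space M) d x y z powr (g1 + g2))) \<le>
    ennreal ((2 * \<kappa>) powr (g1 + g2)) *
      (inverse (ennreal (d x y powr g1)) * inverse (ennreal (d x z powr g2)))"
proof (cases "d x y = 0 \<or> d x z = 0")
  case True
  then have "inverse (ennreal (d x y powr g1)) * inverse (ennreal (d x z powr g2)) = top"
    by (auto simp: ennreal_mult_eq_top_iff)
  then show ?thesis using kappa_ge_1 by (simp add: ennreal_mult_top)
next
  case False
  let ?r = "hypermetric3 (space M) d x y z"
  have pos: "0 < d x y" "0 < d x z"
    using False dist_nonneg[OF x y] dist_nonneg[OF x z] by auto
  have k: "0 < 2 * \<kappa>" using kappa_ge_1 by simp
  have m: "max (d x y) (d x z) \<le> 2 * \<kappa> * ?r"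
    using max_dist_le_hypermetric3[OF x y z] k by (simp add: divide_le_eq mult.commute)
  have "0 < 2 * \<kappa> * ?r" using m pos by auto
  then have r: "0 < ?r" using k by (simp add: zero_less_mult_iff)
  have "d x y powr g1 * d x z powr g2 \<le> (2 * \<kappa> * ?r) powr g1 * (2 * \<kappa> * ?r) powr g2"
    using m pos g by (intro mult_mono powr_mono2) auto
  also have "\<dots> = (2 * \<kappa>) powr (g1 + g2) * ?r powr (g1 + g2)"
    using k r by (simp add: powr_mult powr_add)
  finally have "inverse (?r powr (g1 + g2)) \<le>
      (2 * \<kappa>) powr (g1 + g2) * (inverse (d x y powr g1) * inverse (d x z powr g2))"
    using pos r by (simp add: field_simps)
  then show ?thesis
    using pos r by (simp add: inverse_ennreal ennreal_mult'[symmetric] ennreal_leI)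
qed

text \<open>The hypermetric, like \<open>d\<close> itself, need not be measurable on the product. This is harmless
  because \<open>nn_integral\<close> is monotone on arbitrary functions and the majorant for fixed \<open>x\<close> is a product
  of measurable functions of one variable.\<close>

lemma frac_op_le_riesz_mult:
  assumes [measurable]: "f \<in> borel_measurable M" "h \<in> borel_measurable M"
    and x: "x \<in> space M" and g: "0 < g1" "0 < g2"
  shows "frac_op M d (g1 + g2) f h x \<le>
    ennreal ((2 * \<kappa>) powr (g1 + g2)) * (riesz g1 f x * riesz g2 h x)"
proof -
  interpret sigma_finite_measure M by (rule sigma_finite)
  note [measurable] = dist_measurable[OF x]
  let ?K = "ennreal ((2 * \<kappa>) powr (g1 + g2))"
  define F where "F y = f y * inverse (ennreal (d x y powr g1))" for y
  define H where "H z = h z * inverse (ennreal (d x z powr g2))" for z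
  have [measurable]: "F \<in> borel_measurable M" "H \<in> borel_measurable M"
    unfolding F_def[abs_def] H_def[abs_def] by measurable
  have "frac_op M d (g1 + g2) f h x \<le> (\<integral>\<^sup>+(y, z). ?K * (F y * H z) \<partial>(M \<Otimes>\<^sub>M M))"
    unfolding frac_op_def
  proof (rule nn_integral_mono, clarify)
    fix y z assume "(y, z) \<in> space (M \<Otimes>\<^sub>M M)"
    then have yz: "y \<in> space M" "z \<in> space M" by (auto simp: space_pair_measure)
    have "f y * h z / ennreal (hypermetric3 (space M) d x y z powr (g1 + g2)) \<le>
      (f y * h z) * (?K * (inverse (ennreal (d x y powr g1)) * inverse (ennreal (d x z powr g2))))"
      unfolding divide_ennreal_def
      by (intro mult_left_mono inverse_hypermetric3_powr_le x yz g) auto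
    also have "\<dots> = ?K * (F y * H z)" by (simp only: F_def H_def ac_simps)
    finally show "f y * h z / ennreal (hypermetric3 (space M) d x y z powr (g1 + g2)) \<le> ?K * (F y * H z)" .
  qed
  also have "\<dots> = (\<integral>\<^sup>+y. \<integral>\<^sup>+z. ?K * (F y * H z) \<partial>M \<partial>M)"
    by (subst nn_integral_fst[symmetric]) auto
  also have "\<dots> = ?K * ((\<integral>\<^sup>+y. F y \<partial>M) * (\<integral>\<^sup>+z. H z \<partial>M))"
    by (simp add: nn_integral_cmult nn_integral_multc)
  finally show ?thesis by (simp add: riesz_def F_def H_def)
qed

text \<open>If one norm is \<open>0\<close> and the other \<open>top\<close>, the final right-hand
  side is \<open>0\<close>, so the operator has to vanish outright.\<close>

lemma riesz_eq_0:
  assumes [measurable]: "f \<in> borel_measurable M" and "Lp_size M p f = 0" and x: "x \<in> space M"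
  shows "riesz g f x = 0"
proof -
  note [measurable] = dist_measurable[OF x]
  have "AE y in M. f y = 0"
    using assms(2) by (simp add: Lp_size_def ennreal_powr_eq_0_iff nn_integral_0_iff_AE)
  then show ?thesis unfolding riesz_def
    by (subst nn_integral_0_iff_AE) auto
qed

lemma frac_op_bound:
  assumes p: "1 < p1" "1 < p2" and al: "0 < \<alpha>1" "\<alpha>1 < 1 / p1" "0 < \<alpha>2" "\<alpha>2 < 1 / p2"
    and p3: "1 / p3 = (1 / p1 - \<alpha>1) + (1 / p2 - \<alpha>2)"
  shows "\<exists>C>0. \<forall>f\<in>borel_measurable M. \<forall>h\<in>borel_measurable M.
    Lp_size M p3 (frac_op M d (\<eta> * (1 - \<alpha>1) + \<eta> * (1 - \<alpha>2)) f h)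
      \<le> ennreal C * Lp_size M p1 f * Lp_size M p2 h"
proof -
  define g1 where "g1 = \<eta> * (1 - \<alpha>1)"
  define g2 where "g2 = \<eta> * (1 - \<alpha>2)"
  have "1 / p1 < 1" "1 / p2 < 1" using p by auto
  then have g: "0 < g1" "0 < g2" using al eta_pos by (auto simp: g1_def g2_def)
  define e1 where "e1 = 1 / p1 - \<alpha>1"
  define e2 where "e2 = 1 / p2 - \<alpha>2"
  have e: "0 < e1" "0 < e2" using al by (auto simp: e1_def e2_def)
  have p3': "1 / p3 = e1 + e2" using p3 by (simp add: e1_def e2_def)
  with e have "0 < 1 / p3" by simp
  then have p3pos: "0 < p3" by simp
  \<comment> \<open>This identity is what lets \<open>ennreal_powr_mult_le_add\<close> apply after
    raising to the power \<open>p3\<close>.\<close>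
  have ep: "e1 * p3 + e2 * p3 = 1" using p3' p3pos by (simp add: field_simps)
  obtain C1 where C1: "0 < C1" and bound1: "\<And>f. f \<in> borel_measurable M \<Longrightarrow> Lp_size M p1 f \<noteq> 0 \<Longrightarrow>
    Lp_size M p1 f \<noteq> top \<Longrightarrow> \<exists>u\<in>borel_measurable M. (\<integral>\<^sup>+x. u x \<partial>M) \<le> ennreal C1 \<and>
      (\<forall>x\<in>space M. riesz g1 f x \<le> ennreal C1 * Lp_size M p1 f * ennreal_powr (u x) e1)"
    using riesz_bound[OF p(1) al(1,2)] unfolding g1_def e1_def by blast
  obtain C2 where C2: "0 < C2" and bound2: "\<And>f. f \<in> borel_measurable M \<Longrightarrow> Lp_size M p2 f \<noteq> 0 \<Longrightarrow>
    Lp_size M p2 f \<noteq> top \<Longrightarrow> \<exists>u\<in>borel_measurable M. (\<integral>\<^sup>+x. u x \<partial>M) \<le> ennreal C2 \<and>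
      (\<forall>x\<in>space M. riesz g2 f x \<le> ennreal C2 * Lp_size M p2 f * ennreal_powr (u x) e2)"
    using riesz_bound[OF p(2) al(3,4)] unfolding g2_def e2_def by blast
  define K where "K = (2 * \<kappa>) powr (g1 + g2)"
  have K: "0 < K" using kappa_ge_1 by (simp add: K_def)
  \<comment> \<open>\<open>K\<close> is the kernel loss, \<open>C1 * C2\<close> the product of the
    pointwise constants, and the last factor comes from the integral of
    \<open>u + v\<close>.\<close>
  define C where "C = K * (C1 * C2) * (C1 + C2) powr (1 / p3)"
  have "0 < C" using K C1 C2 by (simp add: C_def)
  have "Lp_size M p3 (frac_op M d (g1 + g2) f h) \<le> ennreal C * Lp_size M p1 f * Lp_size M p2 h"
    if f: "f \<in> borel_measurable M" and h: "h \<in> borel_measurable M" for f h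
  proof -
    let ?T = "frac_op M d (g1 + g2) f h" and ?F = "Lp_size M p1 f" and ?H = "Lp_size M p2 h"
    have T: "?T x \<le> ennreal K * (riesz g1 f x * riesz g2 h x)" if "x \<in> space M" for x
      unfolding K_def by (rule frac_op_le_riesz_mult[OF f h that g])
    \<comment> \<open>Zero norms precede infinite ones because \<open>0 * top = 0\<close>; in the
      second case the right-hand side is \<open>top\<close>.\<close>
    consider "?F = 0 \<or> ?H = 0" | "?F \<noteq> 0" "?H \<noteq> 0" "?F = top \<or> ?H = top"
      | "?F \<noteq> 0" "?F \<noteq> top" "?H \<noteq> 0" "?H \<noteq> top" by blast
    then show ?thesis
    proof cases
      case 1
      have "?T x = 0" if x: "x \<in> space M" for x
        using T[OF x] 1 riesz_eq_0[OF f _ x, of p1 g1] riesz_eq_0[OF h _ x, of p2 g2] by auto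
      then have "(\<integral>\<^sup>+x. ennreal_powr (?T x) p3 \<partial>M) = (\<integral>\<^sup>+x. 0 \<partial>M)"
        by (intro nn_integral_cong) (simp add: ennreal_powr_0)
      then show ?thesis by (simp add: Lp_size_def ennreal_powr_0)
    next
      case 2
      then have "ennreal C * ?F * ?H = top"
        using \<open>0 < C\<close> by (auto simp: ennreal_mult_eq_top_iff)
      then show ?thesis by simp
    next
      case 3
      obtain u where u [measurable]: "u \<in> borel_measurable M" and uC: "(\<integral>\<^sup>+x. u x \<partial>M) \<le> ennreal C1"
        and ub: "\<And>x. x \<in> space M \<Longrightarrow> riesz g1 f x \<le> ennreal C1 * ?F * ennreal_powr (u x) e1"
        using bound1[OF f 3(1,2)] by blast
      obtain v where v [measurable]: "v \<in> borel_measurable M" and vC: "(\<integral>\<^sup>+x. v x \<partial>M) \<le> ennreal C2"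
        and vb: "\<And>x. x \<in> space M \<Longrightarrow> riesz g2 h x \<le> ennreal C2 * ?H * ennreal_powr (v x) e2"
        using bound2[OF h 3(3,4)] by blast
      define D where "D = ennreal (K * (C1 * C2)) * (?F * ?H)"
      have TD: "ennreal_powr (?T x) p3 \<le> ennreal_powr D p3 * (u x + v x)" if x: "x \<in> space M" for x
      proof -
        have "?T x \<le> ennreal K * ((ennreal C1 * ?F * ennreal_powr (u x) e1) *
            (ennreal C2 * ?H * ennreal_powr (v x) e2))"
          using T[OF x] mult_left_mono[OF mult_mono[OF ub[OF x] vb[OF x]], of "ennreal K"]
          by (auto intro: order_trans)
        also have "\<dots> = D * (ennreal_powr (u x) e1 * ennreal_powr (v x) e2)"
          unfolding D_def ennreal_mult'[OF less_imp_le[OF K]] ennreal_mult'[OF less_imp_le[OF C1]]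
          by (simp only: ac_simps)
        finally have "ennreal_powr (?T x) p3 \<le>
            ennreal_powr (D * (ennreal_powr (u x) e1 * ennreal_powr (v x) e2)) p3"
          using p3pos by (intro ennreal_powr_mono) auto
        also have "\<dots> = ennreal_powr D p3 *
            (ennreal_powr (u x) (e1 * p3) * ennreal_powr (v x) (e2 * p3))"
          by (simp add: ennreal_powr_mult ennreal_powr_powr)
        also have "\<dots> \<le> ennreal_powr D p3 * (u x + v x)"
          using e p3pos ep by (intro mult_left_mono ennreal_powr_mult_le_add) auto
        finally show ?thesis .
      qed
      have "(\<integral>\<^sup>+x. ennreal_powr (?T x) p3 \<partial>M) \<le> (\<integral>\<^sup>+x. ennreal_powr D p3 * (u x + v x) \<partial>M)"
        by (intro nn_integral_mono TD)
      also have "\<dots> = ennreal_powr D p3 * ((\<integral>\<^sup>+x. u x \<partial>M) + (\<integral>\<^sup>+x. v x \<partial>M))"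
        by (simp add: nn_integral_cmult nn_integral_add)
      also have "\<dots> \<le> ennreal_powr D p3 * ennreal (C1 + C2)"
        using C1 C2 uC vC by (intro mult_left_mono) (auto intro: add_mono)
      finally have "Lp_size M p3 ?T \<le> ennreal_powr (ennreal_powr D p3 * ennreal (C1 + C2)) (1 / p3)"
        unfolding Lp_size_def using p3pos by (intro ennreal_powr_mono) auto
      also have "\<dots> = D * ennreal_powr (ennreal (C1 + C2)) (1 / p3)"
        using p3pos by (simp add: ennreal_powr_mult ennreal_powr_powr ennreal_powr_1 del: ennreal_plus)
      also have "ennreal_powr (ennreal (C1 + C2)) (1 / p3) = ennreal ((C1 + C2) powr (1 / p3))"
        using C1 C2 by (intro ennreal_powr_ennreal) simp
      also have "D * \<dots> = ennreal C * ?F * ?H"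
        unfolding D_def C_def ennreal_mult''[OF powr_ge_zero] by (simp only: ac_simps)
      finally show ?thesis .
    qed
  qed
  then show ?thesis using \<open>0 < C\<close> unfolding g1_def g2_def by blast
qed

end

theorem theorem1p2:
  fixes M :: "'a measure" and d :: "'a \<Rightarrow> 'a \<Rightarrow> real" and \<eta> \<gamma> p1 p2 p3 :: real
  assumes "\<eta> > 0"
    and "ahlfors_regular_space M d \<eta>"
    and "0 < \<gamma>" and "\<gamma> < 2 * \<eta>"
    and "p1 > 1" and "p2 > 1"
    and "0 < 1 / p3" and "1 / p3 = 1 / p1 + 1 / p2 - (2 * \<eta> - \<gamma>) / \<eta>"
  shows "\<exists>C>0. \<forall>f\<in>borel_measurable M. \<forall>g\<in>borel_measurable M.
           Lp_size M p3 (frac_op M d \<gamma> f g) \<le> ennreal C * Lp_size M p1 f * Lp_size M p2 g"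
proof -
  from assms(2) have hom: "homogeneous_type_space M d" by (simp add: ahlfors_regular_space_def)
  then have qm: "quasi_metric_on (space M) d" by (simp add: homogeneous_type_space_def)
  then obtain \<kappa> where \<kappa>: "1 \<le> \<kappa>"
    "\<forall>x\<in>space M. \<forall>y\<in>space M. \<forall>z\<in>space M. d x z \<le> \<kappa> * (d x y + d y z)"
    by (auto simp: quasi_metric_on_def)
  obtain a A where aA: "0 < a" "a \<le> A"
    "\<forall>x\<in>space M. \<forall>r>0. ennreal (a * r powr \<eta>) \<le> emeasure M (qball (space M) d x r) \<and>
       emeasure M (qball (space M) d x r) \<le> ennreal (A * r powr \<eta>)"
    using assms(2) by (auto simp: ahlfors_regular_space_def)
  interpret ahlfors_quasi_metric M d \<eta> \<kappa> a A
    using assms(1) hom qm \<kappa> aA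
    by unfold_locales (auto simp: quasi_metric_on_def homogeneous_type_space_def)
  define s where "s = (2 * \<eta> - \<gamma>) / \<eta>"
  define S where "S = 1 / p1 + 1 / p2"
  define \<alpha>1 where "\<alpha>1 = (s / S) * (1 / p1)"
  define \<alpha>2 where "\<alpha>2 = (s / S) * (1 / p2)"
  have s: "0 < s" using assms by (simp add: s_def)
  have S: "0 < S" using assms by (simp add: S_def add_pos_pos)
  \<comment> \<open>The gap \<open>S - s\<close> equals \<open>1 / p3\<close>.\<close>
  have sS: "s < S" using assms(7,8) by (simp add: s_def S_def)
  have frac: "0 < s / S" "s / S < 1" using s S sS by auto
  have ip: "0 < 1 / p1" "0 < 1 / p2" using assms(5,6) by auto
  have "\<alpha>1 + \<alpha>2 = s / S * S" by (simp only: \<alpha>1_def \<alpha>2_def S_def distrib_left)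
  with S have sum_s: "\<alpha>1 + \<alpha>2 = s" by simp
  \<comment> \<open>Since the shares sum to the deficit, the kernel exponents
    \<open>\<eta> * (1 - \<alpha>1)\<close> and \<open>\<eta> * (1 - \<alpha>2)\<close> add up to
    \<open>\<gamma>\<close>.\<close>
  then have "\<eta> * (\<alpha>1 + \<alpha>2) = 2 * \<eta> - \<gamma>" using assms(1) by (simp add: s_def)
  then have "\<eta> * (1 - \<alpha>1) + \<eta> * (1 - \<alpha>2) = \<gamma>"
    by (simp add: algebra_simps)
  moreover have "0 < \<alpha>1" "0 < \<alpha>2"
    unfolding \<alpha>1_def \<alpha>2_def by (intro mult_pos_pos frac(1) ip)+
  moreover have "\<alpha>1 < 1 / p1" "\<alpha>2 < 1 / p2"
    using mult_strict_right_mono[OF frac(2) ip(1)] mult_strict_right_mono[OF frac(2) ip(2)]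
    by (simp_all only: \<alpha>1_def \<alpha>2_def mult_1)
  moreover have "1 / p3 = (1 / p1 - \<alpha>1) + (1 / p2 - \<alpha>2)"
    using assms(8) sum_s by (simp add: s_def)
  ultimately show ?thesis
    using frac_op_bound[OF assms(5,6), of \<alpha>1 \<alpha>2 p3] by simp
qed

end
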